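(* Let $H=H^*$ be a selfadjoint operator on the complex Hilbert space $\mathcal H$, let $b>0$, and let $v\in\mathcal H$ be such that $v\in\mathcal D(e^{tH})$ for all $t\in[0,b)$. If there exist $C>0$ and $N>0$ such that $$\|e^{tH}v\|\le\frac{C}{(b-t)^N}\quad\text{for } t\in[0,b),$$ then $\eta:=\lim_{t\to b-}e^{tH}v$ exists in the space $\mathcal H^{-\infty}$ of distribution vectors for the unitary one-parameter group $(e^{itH})_{t\in\mathbb R}$.
   Context: The space of smooth vectors of $(e^{itH})_{t\in\mathbb R}$ is $\mathcal H^\infty=\bigcap_{n}\mathcal D(H^n)$ with the Fréchet topology defined by the seminorms $\|H^nv\|$, $n\in\mathbb N_0$. $\mathcal H^{-\infty}$ is the space of continuous antilinear functionals on $\mathcal H^\infty$, with the weak-$*$-topology (pointwise convergence on $\mathcal H^\infty$); $\mathcal H\hookrightarrow\mathcal H^{-\infty}$ via $w\mapsto\langle\cdot,w\rangle$ (inner product antilinear in the first argument). $\mathcal D(e^{tH})$ is the domain of $e^{tH}$ defined by functional calculus. *)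

theory Defs
  imports "HOL-Analysis.Analysis"
begin

section \<open>Complex Hilbert spaces\<close>

text \<open>The inner product is antilinear in the first and linear in the second argument.
  Antilinearity follows from linearity and conjugate symmetry; the law for
  \<open>cinner x x\<close> gives positive definiteness. Completeness comes from \<open>banach\<close>.\<close>

class complex_hilbert = banach +
  fixes scaleC :: "complex \<Rightarrow> 'a \<Rightarrow> 'a"  (infixr "*\<^sub>C" 75)
    and cinner :: "'a \<Rightarrow> 'a \<Rightarrow> complex"
  assumes scaleC_add_right: "a *\<^sub>C (x + y) = a *\<^sub>C x + a *\<^sub>C y"
    and scaleC_add_left: "(a + b) *\<^sub>C x = a *\<^sub>C x + b *\<^sub>C x"
    and scaleC_scaleC: "a *\<^sub>C b *\<^sub>C x = (a * b) *\<^sub>C x"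
    and scaleC_of_real: "complex_of_real r *\<^sub>C x = r *\<^sub>R x"
    and cinner_commute: "cinner x y = cnj (cinner y x)"
    and cinner_add_right: "cinner x (y + z) = cinner x y + cinner x z"
    and cinner_scaleC_right: "cinner x (a *\<^sub>C y) = a * cinner x y"
    and cinner_self: "cinner x x = complex_of_real ((norm x)\<^sup>2)"

instantiation complex :: complex_hilbert
begin

definition scaleC_complex :: "complex \<Rightarrow> complex \<Rightarrow> complex"
  where "scaleC_complex a x = a * x"

definition cinner_complex :: "complex \<Rightarrow> complex \<Rightarrow> complex"
  where "cinner_complex x y = cnj x * y"

instance
proof
  fix x :: complex
  show "cinner x x = complex_of_real ((norm x)\<^sup>2)"
    unfolding cinner_complex_def complex_norm_square by (rule mult.commute)
qed (simp_all add: scaleC_complex_def cinner_complex_def distrib_left distrib_right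
      scaleR_conv_of_real)

end


section \<open>Unbounded operators\<close>

text \<open>An unbounded operator \<open>T\<close> is represented by its graph, so that \<open>D(T)\<close> is
  \<^term>\<open>Domain T\<close>, equality of operators includes equality of domains, and
  \<^term>\<open>T ^^ n\<close> is the \<open>n\<close>-th power on its natural domain.\<close>

type_synonym 'a operator = "('a \<times> 'a) set"

definition linear_operator :: "'a::complex_hilbert operator \<Rightarrow> bool" where
  "linear_operator T \<longleftrightarrow>
     single_valued T \<and> (0, 0) \<in> T \<and>
     (\<forall>x y x' y'. (x, y) \<in> T \<longrightarrow> (x', y') \<in> T \<longrightarrow> (x + x', y + y') \<in> T) \<and>
     (\<forall>a x y. (x, y) \<in> T \<longrightarrow> (a *\<^sub>C x, a *\<^sub>C y) \<in> T)"

definition op_apply :: "'a operator \<Rightarrow> 'a \<Rightarrow> 'a" where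
  "op_apply T x = (THE y. (x, y) \<in> T)"

definition adjoint_op :: "'a::complex_hilbert operator \<Rightarrow> 'a operator" where
  "adjoint_op T = {(w, u). \<forall>(x, y) \<in> T. cinner w y = cinner u x}"

definition selfadjoint_op :: "'a::complex_hilbert operator \<Rightarrow> bool" where
  "selfadjoint_op T \<longleftrightarrow>
     linear_operator T \<and> closure (Domain T) = UNIV \<and> adjoint_op T = T"


section \<open>Functional calculus\<close>

text \<open>Projection-valued measures on the Borel sets of the real line; countable additivity
  is with respect to the strong operator topology. Values off the Borel sets are irrelevant.\<close>

definition projection_valued_measure :: "(real set \<Rightarrow> 'a \<Rightarrow> 'a::complex_hilbert) \<Rightarrow> bool" where
  "projection_valued_measure E \<longleftrightarrow>
     (\<forall>A \<in> sets borel.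
        (\<forall>x y. E A (x + y) = E A x + E A y) \<and>
        (\<forall>a x. E A (a *\<^sub>C x) = a *\<^sub>C E A x) \<and>
        (\<forall>x. E A (E A x) = E A x) \<and>
        (\<forall>x y. cinner (E A x) y = cinner x (E A y))) \<and>
     (\<forall>x. E {} x = 0) \<and> (\<forall>x. E UNIV x = x) \<and>
     (\<forall>A \<in> sets borel. \<forall>B \<in> sets borel. \<forall>x. E (A \<inter> B) x = E A (E B x)) \<and>
     (\<forall>A :: nat \<Rightarrow> real set. range A \<subseteq> sets borel \<longrightarrow> disjoint_family A \<longrightarrow>
        (\<forall>x. (\<lambda>n. E (A n) x) sums E (\<Union>n. A n) x))"

definition vector_measure :: "(real set \<Rightarrow> 'a \<Rightarrow> 'a::complex_hilbert) \<Rightarrow> 'a \<Rightarrow> real measure" where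
  "vector_measure E x = measure_of UNIV (sets borel) (\<lambda>A. ennreal (Re (cinner x (E A x))))"

definition simple_spectral_integral ::
  "(real set \<Rightarrow> 'a \<Rightarrow> 'a::complex_hilbert) \<Rightarrow> (real \<Rightarrow> complex) \<Rightarrow> 'a \<Rightarrow> 'a" where
  "simple_spectral_integral E s x = (\<Sum>c\<in>range s. c *\<^sub>C E (s -` {c}) x)"

text \<open>The operator \<open>\<integral> f dE\<close> for Borel \<open>f\<close>. Its domain consists of the \<open>x\<close> with
  \<open>\<integral> |f|\<^sup>2 dE\<^sub>x < \<infinity>\<close>, where \<open>E\<^sub>x = \<langle>x, E(\<cdot>) x\<rangle>\<close>; its value at \<open>x\<close> is the value at \<open>f\<close> of the
  continuous extension to \<open>L\<^sup>2(E\<^sub>x)\<close> of the isometry \<open>s \<mapsto> \<integral> s dE x\<close> given on simple functions.\<close>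

definition spectral_integral ::
  "(real set \<Rightarrow> 'a \<Rightarrow> 'a::complex_hilbert) \<Rightarrow> (real \<Rightarrow> complex) \<Rightarrow> 'a operator" where
  "spectral_integral E f = {(x, y).
     (\<integral>\<^sup>+ l. ennreal ((cmod (f l))\<^sup>2) \<partial>vector_measure E x) < \<infinity> \<and>
     (\<exists>s :: nat \<Rightarrow> real \<Rightarrow> complex.
        (\<forall>n. simple_function borel (s n)) \<and>
        (\<lambda>n. \<integral>\<^sup>+ l. ennreal ((cmod (s n l - f l))\<^sup>2) \<partial>vector_measure E x) \<longlonglongrightarrow> 0 \<and>
        (\<lambda>n. simple_spectral_integral E (s n) x) \<longlonglongrightarrow> y)}"

definition spectral_measure_of ::
  "(real set \<Rightarrow> 'a \<Rightarrow> 'a::complex_hilbert) \<Rightarrow> 'a operator \<Rightarrow> bool" where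
  "spectral_measure_of E T \<longleftrightarrow>
     projection_valued_measure E \<and> T = spectral_integral E complex_of_real"

text \<open>\<open>f(T) = \<integral> f dE\<close>, with \<open>E\<close> the spectral measure of the selfadjoint operator \<open>T\<close>. By the
  spectral theorem such an \<open>E\<close> exists and is unique on Borel sets, so the existential
  quantifier just names it.\<close>

definition functional_calculus ::
  "(real \<Rightarrow> complex) \<Rightarrow> 'a::complex_hilbert operator \<Rightarrow> 'a operator" where
  "functional_calculus f T =
     {(x, y). \<exists>E. spectral_measure_of E T \<and> (x, y) \<in> spectral_integral E f}"

definition exp_op :: "real \<Rightarrow> 'a::complex_hilbert operator \<Rightarrow> 'a operator" where
  "exp_op t T = functional_calculus (\<lambda>l. complex_of_real (exp (t * l))) T"


section \<open>Smooth vectors and distribution vectors\<close>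

definition smooth_vectors :: "'a::complex_hilbert operator \<Rightarrow> 'a set" where
  "smooth_vectors H = (\<Inter>n. Domain (H ^^ n))"

text \<open>The locally convex topology of the seminorms \<open>\<parallel>H\<^sup>n v\<parallel>\<close>: the balls of the individual
  seminorms form a subbasis.\<close>

definition smooth_topology :: "'a::complex_hilbert operator \<Rightarrow> 'a topology" where
  "smooth_topology H = topology_generated_by
     {{u \<in> smooth_vectors H. norm (op_apply (H ^^ n) (u - v)) < r} | n v r.
        v \<in> smooth_vectors H \<and> r > 0}"

text \<open>Functionals on the smooth vectors are made \<^const>\<open>extensional\<close>, so that equality of HOL
  functions is equality of functionals.\<close>

definition distribution_vectors :: "'a::complex_hilbert operator \<Rightarrow> ('a \<Rightarrow> complex) set" where
  "distribution_vectors H = {\<phi> \<in> extensional (smooth_vectors H).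
     (\<forall>u \<in> smooth_vectors H. \<forall>w \<in> smooth_vectors H. \<phi> (u + w) = \<phi> u + \<phi> w) \<and>
     (\<forall>a. \<forall>u \<in> smooth_vectors H. \<phi> (a *\<^sub>C u) = cnj a * \<phi> u) \<and>
     continuous_map (smooth_topology H) euclidean \<phi>}"

definition distribution_topology :: "'a::complex_hilbert operator \<Rightarrow> ('a \<Rightarrow> complex) topology" where
  "distribution_topology H =
     subtopology (product_topology (\<lambda>_. euclidean) (smooth_vectors H)) (distribution_vectors H)"

definition distribution_of_vector :: "'a::complex_hilbert operator \<Rightarrow> 'a \<Rightarrow> 'a \<Rightarrow> complex" where
  "distribution_of_vector H w = restrict (\<lambda>u. cinner u w) (smooth_vectors H)"

end

theory Submission
  imports Defs
begin

text \<open>Write \<open>v\<^sub>t = e\<^sup>t\<^sup>H v\<close>. If \<open>u\<close> is a spectrally bounded vector, then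
  \<open>\<langle>u, v\<^sub>t\<rangle> = \<Sum>k. t^k / k! \<langle>H^k u, v\<rangle>\<close>, so \<open>F k t = \<langle>H^k u, v\<^sub>t\<rangle>\<close> satisfies
  \<open>F k' = F (k + 1)\<close>, while \<open>\<bar>F k t\<bar> \<le> C \<parallel>H^k u\<parallel> / (b - t)^N\<close> by hypothesis. Integrating
  the bound for \<open>F k\<close> with \<open>k > N\<close> down to \<open>k = 0\<close> removes the singularity and shows that
  \<open>\<langle>u, v\<^sub>t\<rangle>\<close> is uniformly continuous in \<open>t\<close>, with a modulus that is linear in finitely many
  seminorms \<open>\<parallel>H^k u\<parallel>\<close>. Spectral cutoffs extend this to all smooth \<open>u\<close>, so the limit exists
  pointwise and is bounded by finitely many seminorms.

  The same power series determines \<open>v\<^sub>t\<close> from \<open>H\<close> alone, because spectrally bounded vectors are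
  dense. This replaces the uniqueness of the spectral measure.\<close>

section \<open>Complex inner products\<close>

text \<open>The obstacle is that \<open>exp_op\<close> hides its spectral measure behind an
  existential, so each \<open>t\<close> could come with its own \<open>E\<close>, and even the value
  \<open>op_apply (exp_op t H) v\<close> needs justification. Test vectors are therefore described
  by \<open>H\<close> alone: a \<open>bounded_orbit\<close> grows geometrically, and symmetry of
  \<open>H\<close> lets it be paired with a series computed from any spectral measure. No existence
  theorem for spectral measures is invoked: the hypothesis at \<open>t = 0\<close> supplies one. The
  constants of the modulus are chosen before the test vector; this uniformity gives the limit
  functional its continuity directly, without a Banach-Steinhaus argument. The square root in the
  modulus comes from integrating the last singularity \<open>(b - t) powr (- 1/2)\<close>.\<close>

lemma cinner_add_left: "cinner (x + y) z = cinner x z + cinner y (z::'a::complex_hilbert)"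
  by (metis cinner_commute cinner_add_right complex_cnj_add)

lemma cinner_scaleC_left: "cinner (a *\<^sub>C x) y = cnj a * cinner x (y::'a::complex_hilbert)"
  by (metis cinner_commute cinner_scaleC_right complex_cnj_mult)

lemma cinner_scaleR_right: "cinner x (r *\<^sub>R y) = r *\<^sub>R cinner x (y::'a::complex_hilbert)"
  by (metis cinner_scaleC_right scaleC_of_real scaleR_conv_of_real)

lemma cinner_scaleR_left: "cinner (r *\<^sub>R x) y = r *\<^sub>R cinner x (y::'a::complex_hilbert)"
  by (metis cinner_scaleC_left scaleC_of_real scaleR_conv_of_real complex_cnj_complex_of_real)

lemma norm_scaleC: "norm (a *\<^sub>C x) = cmod a * norm (x::'a::complex_hilbert)"
proof -
  have "complex_of_real ((norm (a *\<^sub>C x))\<^sup>2) = complex_of_real ((cmod a * norm x)\<^sup>2)"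
    unfolding cinner_self[symmetric] cinner_scaleC_left cinner_scaleC_right
    by (simp add: cinner_self power_mult_distrib complex_norm_square mult.commute mult.left_commute
        del: of_real_power)
  then show ?thesis
    by (metis of_real_eq_iff norm_ge_zero mult_nonneg_nonneg power2_eq_iff_nonneg)
qed

text \<open>The class supplies the norm together with its triangle inequality, so Cauchy-Schwarz
  comes out of it: expand the square of \<open>norm (x + y)\<close> and compare with the square of
  \<open>norm x + norm y\<close>.\<close>

lemma Re_cinner_le: "Re (cinner x y) \<le> norm x * norm (y::'a::complex_hilbert)"
proof -
  have "complex_of_real ((norm (x + y))\<^sup>2)
      = cinner x x + cinner x y + cnj (cinner x y) + cinner y y"
    unfolding cinner_self[symmetric] cinner_add_left cinner_add_right
    using cinner_commute[of y x] by simp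
  then have "Re (complex_of_real ((norm (x + y))\<^sup>2)) = (norm x)\<^sup>2 + 2 * Re (cinner x y) + (norm y)\<^sup>2"
    by (simp add: cinner_self del: of_real_power)
  moreover have "(norm (x + y))\<^sup>2 \<le> (norm x + norm y)\<^sup>2"
    by (intro power_mono norm_triangle_ineq) simp
  ultimately show ?thesis
    by (simp add: power2_sum del: of_real_power)
qed

lemma cmod_cinner_le: "cmod (cinner x y) \<le> norm x * norm (y::'a::complex_hilbert)"
proof (cases "cinner x y = 0")
  case False
  \<comment> \<open>A unimodular phase that turns the inner product into its absolute value, which
    reduces the claim to the real part.\<close>
  define a where "a = cnj (cinner x y) / cmod (cinner x y)"
  have "a * cinner x y = cmod (cinner x y)"
    using False unfolding a_def
    by (simp add: complex_norm_square[symmetric] field_simps power2_eq_square)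
  then have "cmod (cinner x y) = Re (cinner x (a *\<^sub>C y))"
    by (simp add: cinner_scaleC_right)
  also have "\<dots> \<le> norm x * norm y"
    using Re_cinner_le[of x "a *\<^sub>C y"] False by (simp add: norm_scaleC a_def norm_divide)
  finally show ?thesis .
qed simp

lemma bounded_linear_cinner_right: "bounded_linear (cinner (x::'a::complex_hilbert))"
  by (rule bounded_linear_intro[where K="norm x"])
    (auto simp: cinner_add_right cinner_scaleR_right cmod_cinner_le mult.commute[of "norm _" "norm x"])

lemma bounded_linear_cinner_left: "bounded_linear (\<lambda>x. cinner x (y::'a::complex_hilbert))"
  by (rule bounded_linear_intro[where K="norm y"])
    (auto simp: cinner_add_left cinner_scaleR_left cmod_cinner_le)

lemmas cinner_diff_right = linear_diff[OF bounded_linear.linear[OF bounded_linear_cinner_right]]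
lemmas cinner_zero_right = linear_0[OF bounded_linear.linear[OF bounded_linear_cinner_right]]
lemmas cinner_sum_right = linear_sum[OF bounded_linear.linear[OF bounded_linear_cinner_right]]
lemmas cinner_sum_left = linear_sum[OF bounded_linear.linear[OF bounded_linear_cinner_left]]

lemma scaleC_zero_left [simp]: "0 *\<^sub>C x = (0::'a::complex_hilbert)"
  using norm_scaleC[of 0 x] by simp

lemma scaleC_one [simp]: "1 *\<^sub>C x = (x::'a::complex_hilbert)"
  using scaleC_of_real[of 1 x] by simp

lemma scaleC_minus_one: "(-1) *\<^sub>C x = - (x::'a::complex_hilbert)"
  using scaleC_of_real[of "-1" x] by simp

lemma bounded_linear_scaleC: "bounded_linear ((*\<^sub>C) a :: 'a::complex_hilbert \<Rightarrow> 'a)"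
proof (rule bounded_linear_intro[where K="cmod a"])
  fix r and x :: 'a
  show "a *\<^sub>C (r *\<^sub>R x) = r *\<^sub>R (a *\<^sub>C x)"
    by (simp only: scaleC_of_real[symmetric] scaleC_scaleC mult.commute)
qed (auto simp: scaleC_add_right norm_scaleC)

lemmas scaleC_sum_right = linear_sum[OF bounded_linear.linear[OF bounded_linear_scaleC]]

section \<open>Projection-valued measures\<close>

locale pvm =
  fixes E :: "real set \<Rightarrow> 'a::complex_hilbert \<Rightarrow> 'a"
  assumes pvm: "projection_valued_measure E"
begin

lemma E_empty [simp]: "E {} x = 0"
  and E_UNIV [simp]: "E UNIV x = x"
  using pvm unfolding projection_valued_measure_def by auto

lemma E_add: "A \<in> sets borel \<Longrightarrow> E A (x + y) = E A x + E A y"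
  and E_scaleC: "A \<in> sets borel \<Longrightarrow> E A (a *\<^sub>C x) = a *\<^sub>C E A x"
  and E_idem: "A \<in> sets borel \<Longrightarrow> E A (E A x) = E A x"
  and E_sym: "A \<in> sets borel \<Longrightarrow> cinner (E A x) y = cinner x (E A y)"
  using bspec[OF conjunct1[OF pvm[unfolded projection_valued_measure_def]], of A] by simp_all

lemma E_E: "A \<in> sets borel \<Longrightarrow> B \<in> sets borel \<Longrightarrow> E A (E B x) = E (A \<inter> B) x"
  using pvm unfolding projection_valued_measure_def by metis

lemma E_sums:
  "range A \<subseteq> sets borel \<Longrightarrow> disjoint_family A \<Longrightarrow> (\<lambda>n. E (A n) x) sums E (\<Union>n. A n) x"
  for A :: "nat \<Rightarrow> real set"
  using pvm unfolding projection_valued_measure_def by blast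

lemma cinner_E_self: "A \<in> sets borel \<Longrightarrow> cinner x (E A x) = complex_of_real ((norm (E A x))\<^sup>2)"
  by (metis E_idem E_sym cinner_self)

lemma norm_E_le:
  assumes "A \<in> sets borel" shows "norm (E A x) \<le> norm x"
proof -
  have "norm (E A x) * norm (E A x) \<le> norm x * norm (E A x)"
    using Re_cinner_le[of x "E A x"] cinner_E_self[OF assms, of x]
    by (simp add: power2_eq_square del: of_real_power)
  then show ?thesis
    by (cases "E A x = 0") simp_all
qed

lemma bounded_linear_E:
  assumes "A \<in> sets borel" shows "bounded_linear (E A)"
proof (rule bounded_linear_intro[where K=1])
  show "E A (r *\<^sub>R x) = r *\<^sub>R E A x" for r x
    using E_scaleC[OF assms, of "complex_of_real r" x] by (simp only: scaleC_of_real)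
qed (use assms in \<open>auto simp: E_add norm_E_le\<close>)

lemmas E_sum = linear_sum[OF bounded_linear.linear[OF bounded_linear_E]]

lemma E_Un:
  assumes "A \<in> sets borel" "B \<in> sets borel" "A \<inter> B = {}"
  shows "E (A \<union> B) x = E A x + E B x"
proof -
  have "(\<lambda>n. E (binaryset A B n) x) sums E (\<Union>n. binaryset A B n) x"
    by (rule E_sums) (use assms in \<open>auto simp: range_binaryset_eq disjoint_family_on_def binaryset_def\<close>)
  moreover have "(\<lambda>n. E (binaryset A B n) x) sums (E A x + E B x)"
    by (rule binaryset_sums) simp
  ultimately show ?thesis
    unfolding UN_binaryset_eq by (rule sums_unique2)
qed

lemma E_finite_UN:
  assumes "finite I" "\<And>i. i \<in> I \<Longrightarrow> A i \<in> sets borel" "disjoint_family_on A I"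
  shows "E (\<Union>i\<in>I. A i) x = (\<Sum>i\<in>I. E (A i) x)"
  using assms
proof (induction I rule: finite_induct)
  case (insert i I)
  have "E (A i \<union> (\<Union>i\<in>I. A i)) x = E (A i) x + E (\<Union>i\<in>I. A i) x"
    by (rule E_Un) (use insert in \<open>auto simp: disjoint_family_on_insert\<close>)
  then show ?case
    using insert by (simp add: disjoint_family_on_insert)
qed simp

section \<open>The scalar measures attached to vectors\<close>

abbreviation \<mu> :: "'a \<Rightarrow> real measure" where "\<mu> \<equiv> vector_measure E"

lemma sets_vector_measure [simp, measurable_cong]: "sets (\<mu> x) = sets borel"
  unfolding vector_measure_def by (metis sets.sets_measure_of_eq space_borel)

lemma space_vector_measure [simp]: "space (\<mu> x) = UNIV"
  using sets_eq_imp_space_eq[OF sets_vector_measure] by simp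

text \<open>\<open>measure_of\<close> returns the intended values only for a countably additive set
  function. Strong countable additivity passes through the inner product, and symmetric idempotents
  make the values nonnegative.\<close>

lemma emeasure_vector_measure:
  assumes "A \<in> sets borel"
  shows "emeasure (\<mu> x) A = ennreal ((norm (E A x))\<^sup>2)"
proof -
  let ?m = "\<lambda>A. ennreal (Re (cinner x (E A x)))"
  have "countably_additive (sets borel) ?m"
  proof (rule countably_additiveI)
    fix A :: "nat \<Rightarrow> real set"
    assume A: "range A \<subseteq> sets borel" "disjoint_family A"
    have "(\<lambda>n. Re (cinner x (E (A n) x))) sums Re (cinner x (E (\<Union>n. A n) x))"
      by (rule sums_Re[OF bounded_linear.sums[OF bounded_linear_cinner_right E_sums[OF A]]])
    moreover have "0 \<le> Re (cinner x (E (A n) x))" for n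
      using A cinner_E_self[of "A n" x] by (simp add: range_subsetD del: of_real_power)
    ultimately show "(\<Sum>i. ?m (A i)) = ?m (\<Union> (range A))"
      by (simp add: suminf_ennreal2 sums_unique[symmetric] sums_summable)
  qed
  moreover have "sigma_sets UNIV (sets borel) = sets (borel :: real measure)"
    using sets.sigma_sets_eq[of borel] by simp
  ultimately have "emeasure (\<mu> x) A = ?m A"
    by (intro emeasure_measure_of[OF vector_measure_def])
      (use assms in \<open>auto simp: positive_def vector_measure_def cinner_zero_right\<close>)
  then show ?thesis
    using assms by (simp add: cinner_E_self del: of_real_power)
qed

section \<open>Spectral integrals of simple functions\<close>

abbreviation S :: "(real \<Rightarrow> complex) \<Rightarrow> 'a \<Rightarrow> 'a" where "S \<equiv> simple_spectral_integral E"

text \<open>Two simple functions have unrelated ranges. Writing both as functions of their pairing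
  \<open>p\<close> puts all sums over one index set, since level sets of \<open>h (p l)\<close> are
  finite disjoint unions of fibres of \<open>p\<close>. \<open>Q\<close> may exceed the range
  because empty fibres contribute zero.\<close>

lemma simple_spectral_integral_compose:
  assumes "finite Q" "range p \<subseteq> Q" "\<And>q. p -` {q} \<in> sets borel"
  shows "S (\<lambda>l. h (p l)) x = (\<Sum>q\<in>Q. h q *\<^sub>C E (p -` {q}) x)"
proof -
  have fin: "finite (range p)" "finite (range (\<lambda>l. h (p l)))"
    using assms(1,2) finite_subset[of "range p" Q] by (auto simp: image_image[symmetric])
  have "S (\<lambda>l. h (p l)) x = (\<Sum>c\<in>range (\<lambda>l. h (p l)). \<Sum>q | q \<in> range p \<and> h q = c. h q *\<^sub>C E (p -` {q}) x)"
    unfolding simple_spectral_integral_def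
  proof (rule sum.cong[OF refl])
    fix c
    have "(\<lambda>l. h (p l)) -` {c} = (\<Union>q\<in>{q. q \<in> range p \<and> h q = c}. p -` {q})"
      by auto
    moreover have "E (\<Union>q\<in>{q. q \<in> range p \<and> h q = c}. p -` {q}) x
        = (\<Sum>q | q \<in> range p \<and> h q = c. E (p -` {q}) x)"
      by (rule E_finite_UN) (use fin assms(3) in \<open>auto simp: disjoint_family_on_def\<close>)
    ultimately show "c *\<^sub>C E ((\<lambda>l. h (p l)) -` {c}) x
        = (\<Sum>q | q \<in> range p \<and> h q = c. h q *\<^sub>C E (p -` {q}) x)"
      by (simp add: scaleC_sum_right)
  qed
  also have "\<dots> = (\<Sum>q\<in>range p. h q *\<^sub>C E (p -` {q}) x)"
    by (rule sum.group) (use fin in auto)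
  also have "\<dots> = (\<Sum>q\<in>Q. h q *\<^sub>C E (p -` {q}) x)"
  proof (rule sum.mono_neutral_left[OF assms(1,2)], intro ballI)
    fix q assume "q \<in> Q - range p"
    then have "p -` {q} = {}" by auto
    then show "h q *\<^sub>C E (p -` {q}) x = 0"
      using linear_0[OF bounded_linear.linear[OF bounded_linear_scaleC]] by simp
  qed
  finally show ?thesis .
qed

lemma simple_functionD:
  assumes "simple_function borel s"
  shows "finite (range s)" "s -` {c} \<in> sets borel"
proof -
  show "finite (range s)"
    using assms by (simp add: simple_function_def)
  show "s -` {c} \<in> sets borel"
  proof (cases "c \<in> range s")
    case False
    then have "s -` {c} = {}" by auto
    then show ?thesis by simp
  qed (use assms in \<open>auto simp: simple_function_def\<close>)
qed

lemma S_add: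
  assumes "simple_function borel s" "simple_function borel s'"
  shows "S (\<lambda>l. s l + s' l) x = S s x + S s' x"
proof -
  let ?p = "\<lambda>l. (s l, s' l)"
  have p: "simple_function borel ?p" using assms by (rule simple_function_Pair)
  note * = simple_spectral_integral_compose[OF simple_functionD(1)[OF p] order_refl simple_functionD(2)[OF p]]
  show ?thesis
    using *[of "\<lambda>q. fst q + snd q" x] *[of fst x] *[of snd x]
    by (simp add: scaleC_add_left sum.distrib)
qed

lemma S_scaleC:
  assumes "simple_function borel s"
  shows "S (\<lambda>l. c * s l) x = c *\<^sub>C S s x"
  using simple_spectral_integral_compose[OF simple_functionD(1)[OF assms] order_refl
      simple_functionD(2)[OF assms], of "\<lambda>z. c * z" x]
  by (simp add: simple_spectral_integral_def scaleC_sum_right scaleC_scaleC)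

lemma S_diff:
  assumes "simple_function borel s" "simple_function borel s'"
  shows "S (\<lambda>l. s l - s' l) x = S s x - S s' x"
proof -
  have "simple_function borel (\<lambda>l. (-1) * s' l)"
    using assms(2) by (rule simple_function_compose1)
  from S_add[OF assms(1) this] S_scaleC[OF assms(2), of "-1"] show ?thesis
    by (simp add: scaleC_minus_one)
qed

lemma S_mult:
  assumes "simple_function borel s" "simple_function borel s'"
  shows "S (\<lambda>l. s l * s' l) x = S s (S s' x)"
proof -
  let ?p = "\<lambda>l. (s l, s' l)"
  have p: "simple_function borel ?p" using assms by (rule simple_function_Pair)
  note fin = simple_functionD(1)[OF assms(1)] simple_functionD(1)[OF assms(2)]
  note b = simple_functionD(2)[OF assms(1)] simple_functionD(2)[OF assms(2)]
  \<comment> \<open>The sum runs over the full rectangle of values, not only over the range of the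
    pairing, so that it factors.\<close>
  have "S (\<lambda>l. s l * s' l) x
      = (\<Sum>q\<in>range s \<times> range s'. (fst q * snd q) *\<^sub>C E (?p -` {q}) x)"
    using simple_spectral_integral_compose[of "range s \<times> range s'" ?p "\<lambda>q. fst q * snd q" x]
      fin simple_functionD(2)[OF p] by auto
  also have "\<dots> = (\<Sum>c\<in>range s. \<Sum>d\<in>range s'. (c * d) *\<^sub>C E (?p -` {(c, d)}) x)"
    by (simp add: sum.cartesian_product case_prod_beta)
  also have "\<dots> = (\<Sum>c\<in>range s. \<Sum>d\<in>range s'. c *\<^sub>C d *\<^sub>C E (s -` {c}) (E (s' -` {d}) x))"
  proof (intro sum.cong refl)
    fix c d
    have "?p -` {(c, d)} = s -` {c} \<inter> s' -` {d}" by auto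
    then show "(c * d) *\<^sub>C E (?p -` {(c, d)}) x = c *\<^sub>C d *\<^sub>C E (s -` {c}) (E (s' -` {d}) x)"
      by (simp add: scaleC_scaleC E_E b)
  qed
  also have "\<dots> = S s (S s' x)"
    unfolding simple_spectral_integral_def by (simp add: b E_sum E_scaleC scaleC_sum_right)
  finally show ?thesis .
qed

lemma E_S:
  assumes "simple_function borel s" "A \<in> sets borel"
  shows "E A (S s x) = S s (E A x)"
  unfolding simple_spectral_integral_def
  by (simp add: assms simple_functionD(2)[OF assms(1)] E_sum E_scaleC E_E Int_commute)

text \<open>Pythagoras: distinct level sets are disjoint, so the corresponding components of
  \<open>x\<close> are orthogonal. This isometry turns L^2 estimates into norm estimates.\<close>

lemma norm_S:
  assumes "simple_function borel s"
  shows "ennreal ((norm (S s x))\<^sup>2) = (\<integral>\<^sup>+ l. ennreal ((cmod (s l))\<^sup>2) \<partial>\<mu> x)"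
proof -
  note fin = simple_functionD(1)[OF assms] and b = simple_functionD(2)[OF assms]
  have orth: "cinner (E (s -` {c}) x) (E (s -` {d}) x)
      = (if c = d then complex_of_real ((norm (E (s -` {c}) x))\<^sup>2) else 0)" for c d
  proof (cases "c = d")
    case False
    then have "s -` {c} \<inter> s -` {d} = {}" by auto
    then show ?thesis using False by (simp add: E_sym b E_E cinner_zero_right)
  qed (simp add: cinner_self del: of_real_power)
  have "complex_of_real ((norm (S s x))\<^sup>2)
      = (\<Sum>c\<in>range s. \<Sum>d\<in>range s. cnj c * (d * cinner (E (s -` {c}) x) (E (s -` {d}) x)))"
    unfolding cinner_self[symmetric] simple_spectral_integral_def cinner_sum_left
    unfolding cinner_sum_right cinner_scaleC_left cinner_scaleC_right
    by (simp only: mult.left_commute)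
  also have "\<dots> = (\<Sum>c\<in>range s. cnj c * (c * complex_of_real ((norm (E (s -` {c}) x))\<^sup>2)))"
    unfolding orth by (intro sum.cong refl) (simp add: fin if_distrib cong: if_cong)
  also have "\<dots> = complex_of_real (\<Sum>c\<in>range s. (cmod c)\<^sup>2 * (norm (E (s -` {c}) x))\<^sup>2)"
    unfolding of_real_sum of_real_mult complex_norm_square
    by (intro sum.cong refl) (simp add: mult_ac)
  finally have *: "(norm (S s x))\<^sup>2 = (\<Sum>c\<in>range s. (cmod c)\<^sup>2 * (norm (E (s -` {c}) x))\<^sup>2)"
    unfolding of_real_eq_iff .
  have "(\<integral>\<^sup>+ l. ennreal ((cmod (s l))\<^sup>2) \<partial>\<mu> x)
      = (\<integral>\<^sup>+ l. (\<Sum>c\<in>range s. ennreal ((cmod c)\<^sup>2) * indicator (s -` {c}) l) \<partial>\<mu> x)"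
  proof (intro nn_integral_cong)
    fix l
    have "(\<Sum>c\<in>range s. ennreal ((cmod c)\<^sup>2) * indicator (s -` {c}) l)
        = (\<Sum>c\<in>{s l}. ennreal ((cmod c)\<^sup>2) * indicator (s -` {c}) l)"
      by (rule sum.mono_neutral_right) (use fin in auto)
    then show "ennreal ((cmod (s l))\<^sup>2) = (\<Sum>c\<in>range s. ennreal ((cmod c)\<^sup>2) * indicator (s -` {c}) l)"
      by simp
  qed
  also have "\<dots> = (\<Sum>c\<in>range s. ennreal ((cmod c)\<^sup>2) * ennreal ((norm (E (s -` {c}) x))\<^sup>2))"
    by (subst nn_integral_sum) (auto simp: b nn_integral_cmult_indicator emeasure_vector_measure
        intro!: borel_measurable_times_ennreal borel_measurable_indicator)
  also have "\<dots> = ennreal ((norm (S s x))\<^sup>2)"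
    unfolding * by (simp add: ennreal_mult[symmetric] sum_ennreal)
  finally show ?thesis ..
qed

end

section \<open>The spectral integral\<close>

context pvm
begin

abbreviation sqint :: "(real \<Rightarrow> complex) \<Rightarrow> 'a \<Rightarrow> ennreal" where
  "sqint f x \<equiv> \<integral>\<^sup>+ l. ennreal ((cmod (f l))\<^sup>2) \<partial>\<mu> x"

text \<open>\<open>sqint\<close> is a squared norm, hence the factor 2 from
  \<open>(a + b)^2 \<le> 2 a^2 + 2 b^2\<close>; working with squares avoids roots in
  \<open>ennreal\<close>.\<close>

lemma sqint_add_le:
  assumes [measurable]: "f \<in> borel_measurable borel" "g \<in> borel_measurable borel"
  shows "sqint (\<lambda>l. f l + g l) x \<le> 2 * sqint f x + 2 * sqint g x"
proof -
  have "sqint (\<lambda>l. f l + g l) x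
      \<le> (\<integral>\<^sup>+ l. 2 * ennreal ((cmod (f l))\<^sup>2) + 2 * ennreal ((cmod (g l))\<^sup>2) \<partial>\<mu> x)"
  proof (intro nn_integral_mono)
    fix l
    have "(cmod (f l + g l))\<^sup>2 \<le> (cmod (f l) + cmod (g l))\<^sup>2"
      by (intro power_mono norm_triangle_ineq) simp
    also have "\<dots> \<le> 2 * (cmod (f l))\<^sup>2 + 2 * (cmod (g l))\<^sup>2"
      using sum_squares_bound[of "cmod (f l)" "cmod (g l)"] by (simp add: power2_sum)
    finally have "ennreal ((cmod (f l + g l))\<^sup>2)
        \<le> ennreal (2 * (cmod (f l))\<^sup>2 + 2 * (cmod (g l))\<^sup>2)"
      by (rule ennreal_leI)
    then show "ennreal ((cmod (f l + g l))\<^sup>2) \<le> 2 * ennreal ((cmod (f l))\<^sup>2) + 2 * ennreal ((cmod (g l))\<^sup>2)"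
      by (simp add: ennreal_plus ennreal_mult)
  qed
  also have "\<dots> = 2 * sqint f x + 2 * sqint g x"
    by (simp add: nn_integral_add nn_integral_cmult)
  finally show ?thesis .
qed

lemma sqint_triangle:
  assumes "f \<in> borel_measurable borel" "g \<in> borel_measurable borel" "h \<in> borel_measurable borel"
  shows "sqint (\<lambda>l. f l - h l) x \<le> 2 * sqint (\<lambda>l. f l - g l) x + 2 * sqint (\<lambda>l. g l - h l) x"
  using sqint_add_le[of "\<lambda>l. f l - g l" "\<lambda>l. g l - h l" x] assms by simp

lemma sqint_mult_le:
  assumes [measurable]: "f \<in> borel_measurable borel" and "\<And>l. cmod (g l) \<le> c"
  shows "sqint (\<lambda>l. g l * f l) x \<le> ennreal (c\<^sup>2) * sqint f x"
proof -
  have "sqint (\<lambda>l. g l * f l) x \<le> (\<integral>\<^sup>+ l. ennreal (c\<^sup>2) * ennreal ((cmod (f l))\<^sup>2) \<partial>\<mu> x)"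
    using assms(2)
    by (intro nn_integral_mono)
      (auto simp: ennreal_mult[symmetric] norm_mult power_mult_distrib
        intro!: ennreal_leI mult_right_mono power_mono)
  then show ?thesis by (simp add: nn_integral_cmult)
qed

text \<open>The approximating sequence is traded for one approximant per tolerance, which is the
  form a diagonal choice needs. A single \<open>e\<close> controls two different quantities, an
  integral and a norm.\<close>

lemma spectral_integral_iff:
  "(x, y) \<in> spectral_integral E f \<longleftrightarrow> sqint f x < \<infinity> \<and>
     (\<forall>e>0. \<exists>s. simple_function borel s \<and> sqint (\<lambda>l. s l - f l) x < ennreal e \<and> norm (S s x - y) < e)"
  (is "_ \<longleftrightarrow> _ \<and> ?R")
proof -
  have "?R \<longleftrightarrow> (\<exists>s. (\<forall>n. simple_function borel (s n)) \<and>
        (\<lambda>n. sqint (\<lambda>l. s n l - f l) x) \<longlonglongrightarrow> 0 \<and> (\<lambda>n. S (s n) x) \<longlonglongrightarrow> y)" (is "_ = ?L")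
  proof
    assume ?R
    moreover have "0 < 1 / real (Suc n)" for n by simp
    ultimately have "\<forall>n. \<exists>s. simple_function borel s \<and> sqint (\<lambda>l. s l - f l) x < ennreal (1 / Suc n)
        \<and> norm (S s x - y) < 1 / Suc n"
      by blast
    from choice[OF this] obtain s where s: "\<And>n. simple_function borel (s n)"
      "\<And>n. sqint (\<lambda>l. s n l - f l) x < ennreal (1 / Suc n)" "\<And>n. norm (S (s n) x - y) < 1 / Suc n"
      by blast
    have lim: "(\<lambda>n. 1 / real (Suc n)) \<longlonglongrightarrow> 0"
      using LIMSEQ_Suc[OF lim_1_over_n] by simp
    have "(\<lambda>n. sqint (\<lambda>l. s n l - f l) x) \<longlonglongrightarrow> 0"
    proof (rule tendsto_sandwich[of "\<lambda>_. 0" _ _ "\<lambda>n. ennreal (1 / Suc n)"])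
      show "(\<lambda>n. ennreal (1 / real (Suc n))) \<longlonglongrightarrow> 0"
        using tendsto_ennrealI[OF lim] by simp
    qed (simp_all add: less_imp_le[OF s(2)] always_eventually del: of_nat_Suc)
    moreover have "(\<lambda>n. S (s n) x) \<longlonglongrightarrow> y"
    proof (rule LIM_zero_cancel, rule tendsto_norm_zero_cancel)
      show "(\<lambda>n. norm (S (s n) x - y)) \<longlonglongrightarrow> 0"
        by (rule tendsto_sandwich[OF _ _ tendsto_const lim])
          (simp_all add: less_imp_le[OF s(3)] always_eventually del: of_nat_Suc)
    qed
    ultimately show ?L using s(1) by blast
  next
    assume ?L
    then obtain s where s: "\<And>n. simple_function borel (s n)"
      "(\<lambda>n. sqint (\<lambda>l. s n l - f l) x) \<longlonglongrightarrow> 0" "(\<lambda>n. S (s n) x) \<longlonglongrightarrow> y"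
      by blast
    show ?R
    proof (intro allI impI)
      fix e :: real assume "e > 0"
      then have "eventually (\<lambda>n. sqint (\<lambda>l. s n l - f l) x < ennreal e) sequentially"
        "eventually (\<lambda>n. norm (S (s n) x - y) < e) sequentially"
        using order_tendstoD(2)[OF s(2)] tendstoD[OF s(3)] by (auto simp: dist_norm)
      then have "eventually (\<lambda>n. sqint (\<lambda>l. s n l - f l) x < ennreal e \<and> norm (S (s n) x - y) < e) sequentially"
        by (rule eventually_conj)
      then show "\<exists>s. simple_function borel s \<and> sqint (\<lambda>l. s l - f l) x < ennreal e \<and> norm (S s x - y) < e"
        using s(1) by (auto dest: eventually_happens'[OF sequentially_bot])
    qed
  qed
  then show ?thesis unfolding spectral_integral_def by simp
qed

lemma spectral_integralE:
  assumes "(x, y) \<in> spectral_integral E f"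
  obtains s where "\<And>n. simple_function borel (s n)"
    "(\<lambda>n. sqint (\<lambda>l. s n l - f l) x) \<longlonglongrightarrow> 0" "(\<lambda>n. S (s n) x) \<longlonglongrightarrow> y"
  using assms unfolding spectral_integral_def by blast

lemma spectral_integralI:
  assumes "sqint f x < \<infinity>" "\<And>n. simple_function borel (s n)"
    "(\<lambda>n. sqint (\<lambda>l. s n l - f l) x) \<longlonglongrightarrow> 0" "(\<lambda>n. S (s n) x) \<longlonglongrightarrow> y"
  shows "(x, y) \<in> spectral_integral E f"
  using assms unfolding spectral_integral_def by blast

lemma spectral_integral_finite: "(x, y) \<in> spectral_integral E f \<Longrightarrow> sqint f x < \<infinity>"
  unfolding spectral_integral_def by blast

lemma ennreal_mult_tendsto_0:
  "f \<longlonglongrightarrow> 0 \<Longrightarrow> (\<lambda>n. ennreal c * f n) \<longlonglongrightarrow> (0::ennreal)"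
  using ennreal_tendsto_cmult[of "ennreal c" f 0 sequentially] by simp

lemma ennreal_2_mult_tendsto_0:
  "f \<longlonglongrightarrow> 0 \<Longrightarrow> (\<lambda>n. 2 * f n) \<longlonglongrightarrow> (0::ennreal)"
  using ennreal_tendsto_cmult[of 2 f 0 sequentially] by simp

lemma tendsto_0_le:
  fixes f :: "nat \<Rightarrow> ennreal"
  assumes "\<And>n. f n \<le> g n" "g \<longlonglongrightarrow> 0"
  shows "f \<longlonglongrightarrow> 0"
  by (rule tendsto_sandwich[OF _ _ tendsto_const assms(2)]) (auto intro: always_eventually assms(1))

section \<open>Algebra, projections and closedness of spectral integrals\<close>

lemma spectral_integral_add:
  assumes "(x, y) \<in> spectral_integral E f" "(x, z) \<in> spectral_integral E g"
    and [measurable]: "f \<in> borel_measurable borel" "g \<in> borel_measurable borel"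
  shows "(x, y + z) \<in> spectral_integral E (\<lambda>l. f l + g l)"
proof -
  obtain s where s: "\<And>n. simple_function borel (s n)"
    "(\<lambda>n. sqint (\<lambda>l. s n l - f l) x) \<longlonglongrightarrow> 0" "(\<lambda>n. S (s n) x) \<longlonglongrightarrow> y"
    by (rule spectral_integralE[OF assms(1)]) blast
  obtain s' where s': "\<And>n. simple_function borel (s' n)"
    "(\<lambda>n. sqint (\<lambda>l. s' n l - g l) x) \<longlonglongrightarrow> 0" "(\<lambda>n. S (s' n) x) \<longlonglongrightarrow> z"
    by (rule spectral_integralE[OF assms(2)]) blast
  note [measurable] = borel_measurable_simple_function[OF s(1)] borel_measurable_simple_function[OF s'(1)]
  show ?thesis
  proof (rule spectral_integralI[where s="\<lambda>n l. s n l + s' n l"])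
    show "sqint (\<lambda>l. f l + g l) x < \<infinity>"
      using sqint_add_le[of f g x] assms(3,4)
        spectral_integral_finite[OF assms(1)] spectral_integral_finite[OF assms(2)]
      by (auto simp: ennreal_mult_less_top intro: le_less_trans)
    show "simple_function borel (\<lambda>l. s n l + s' n l)" for n
      using s(1) s'(1) by (rule simple_function_add)
    show "(\<lambda>n. S (\<lambda>l. s n l + s' n l) x) \<longlonglongrightarrow> y + z"
      by (simp add: S_add s s' tendsto_add)
    show "(\<lambda>n. sqint (\<lambda>l. s n l + s' n l - (f l + g l)) x) \<longlonglongrightarrow> 0"
    proof (rule tendsto_0_le)
      show "sqint (\<lambda>l. s n l + s' n l - (f l + g l)) x
          \<le> 2 * sqint (\<lambda>l. s n l - f l) x + 2 * sqint (\<lambda>l. s' n l - g l) x" for n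
        using sqint_add_le[of "\<lambda>l. s n l - f l" "\<lambda>l. s' n l - g l" x] by (simp add: algebra_simps)
      show "(\<lambda>n. 2 * sqint (\<lambda>l. s n l - f l) x + 2 * sqint (\<lambda>l. s' n l - g l) x) \<longlonglongrightarrow> 0"
        using tendsto_add[OF ennreal_2_mult_tendsto_0[OF s(2)] ennreal_2_mult_tendsto_0[OF s'(2)]] by simp
    qed
  qed
qed

lemma spectral_integral_scaleC:
  assumes "(x, y) \<in> spectral_integral E f" and [measurable]: "f \<in> borel_measurable borel"
  shows "(x, c *\<^sub>C y) \<in> spectral_integral E (\<lambda>l. c * f l)"
proof -
  obtain s where s: "\<And>n. simple_function borel (s n)"
    "(\<lambda>n. sqint (\<lambda>l. s n l - f l) x) \<longlonglongrightarrow> 0" "(\<lambda>n. S (s n) x) \<longlonglongrightarrow> y"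
    by (rule spectral_integralE[OF assms(1)]) blast
  note [measurable] = borel_measurable_simple_function[OF s(1)]
  show ?thesis
  proof (rule spectral_integralI[where s="\<lambda>n l. c * s n l"])
    show "sqint (\<lambda>l. c * f l) x < \<infinity>"
      using sqint_mult_le[OF assms(2), of "\<lambda>_. c" "cmod c" x] spectral_integral_finite[OF assms(1)]
      by (auto simp: ennreal_mult_less_top intro: le_less_trans)
    show "simple_function borel (\<lambda>l. c * s n l)" for n
      using s(1) by (rule simple_function_compose1)
    show "(\<lambda>n. S (\<lambda>l. c * s n l) x) \<longlonglongrightarrow> c *\<^sub>C y"
      unfolding S_scaleC[OF s(1)] by (rule bounded_linear.tendsto[OF bounded_linear_scaleC s(3)])
    show "(\<lambda>n. sqint (\<lambda>l. c * s n l - c * f l) x) \<longlonglongrightarrow> 0"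
    proof (rule tendsto_0_le[OF _ ennreal_mult_tendsto_0[OF s(2)]])
      show "sqint (\<lambda>l. c * s n l - c * f l) x \<le> ennreal ((cmod c)\<^sup>2) * sqint (\<lambda>l. s n l - f l) x" for n
        using sqint_mult_le[of "\<lambda>l. s n l - f l" "\<lambda>_. c" "cmod c" x] by (simp add: right_diff_distrib)
    qed
  qed
qed

lemma simple_function_bounded:
  assumes "simple_function borel (s :: real \<Rightarrow> complex)"
  obtains c where "\<And>l. cmod (s l) \<le> c"
  using finite_imp_bounded[OF simple_functionD(1)[OF assms]] unfolding bounded_iff by auto

lemma bounded_linear_S:
  assumes "simple_function borel s"
  shows "bounded_linear (S s)"
  unfolding simple_spectral_integral_def
  by (intro bounded_linear_sum bounded_linear_compose[OF bounded_linear_scaleC]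
      bounded_linear_E simple_functionD(2)[OF assms])

text \<open>On values, a simple multiplier acts as the bounded operator \<open>S g\<close>. Together
  with closedness this later yields multiplication by the identity function on a bounded
  window.\<close>

lemma spectral_integral_mult_simple:
  assumes "(x, y) \<in> spectral_integral E f" and [measurable]: "f \<in> borel_measurable borel"
    and g: "simple_function borel g"
  shows "(x, S g y) \<in> spectral_integral E (\<lambda>l. g l * f l)"
proof -
  obtain s where s: "\<And>n. simple_function borel (s n)"
    "(\<lambda>n. sqint (\<lambda>l. s n l - f l) x) \<longlonglongrightarrow> 0" "(\<lambda>n. S (s n) x) \<longlonglongrightarrow> y"
    by (rule spectral_integralE[OF assms(1)]) blast
  obtain c where c: "\<And>l. cmod (g l) \<le> c" by (rule simple_function_bounded[OF g]) blast
  note [measurable] = borel_measurable_simple_function[OF s(1)] borel_measurable_simple_function[OF g]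
  show ?thesis
  proof (rule spectral_integralI[where s="\<lambda>n l. g l * s n l"])
    show "sqint (\<lambda>l. g l * f l) x < \<infinity>"
      using sqint_mult_le[OF assms(2), of g c x] c spectral_integral_finite[OF assms(1)]
      by (auto simp: ennreal_mult_less_top intro: le_less_trans)
    show "simple_function borel (\<lambda>l. g l * s n l)" for n
      using g s(1) by (rule simple_function_mult)
    show "(\<lambda>n. S (\<lambda>l. g l * s n l) x) \<longlonglongrightarrow> S g y"
      unfolding S_mult[OF g s(1)] by (rule bounded_linear.tendsto[OF bounded_linear_S[OF g] s(3)])
    show "(\<lambda>n. sqint (\<lambda>l. g l * s n l - g l * f l) x) \<longlonglongrightarrow> 0"
    proof (rule tendsto_0_le[OF _ ennreal_mult_tendsto_0[OF s(2)]])
      show "sqint (\<lambda>l. g l * s n l - g l * f l) x \<le> ennreal (c\<^sup>2) * sqint (\<lambda>l. s n l - f l) x" for n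
        using sqint_mult_le[of "\<lambda>l. s n l - f l" g c x] c by (simp add: right_diff_distrib)
    qed
  qed
qed

text \<open>The projections commute and \<open>E A\<close> is a contraction, so the measure of
  \<open>E A x\<close> is dominated by that of \<open>x\<close> on every Borel set.\<close>

lemma sqint_E_le:
  assumes "A \<in> sets borel"
  shows "sqint f (E A x) \<le> sqint f x"
proof (rule nn_integral_mono_measure)
  have "emeasure (\<mu> (E A x)) B \<le> emeasure (\<mu> x) B" if B: "B \<in> sets borel" for B
  proof -
    have "E B (E A x) = E A (E B x)" by (simp add: E_E assms B Int_commute)
    then have "norm (E B (E A x)) \<le> norm (E B x)" by (simp add: norm_E_le assms)
    then show ?thesis
      by (simp add: emeasure_vector_measure B ennreal_leI power_mono)
  qed
  then show "\<mu> (E A x) \<le> \<mu> x" by (subst le_measure) simp_all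
qed simp

lemma spectral_integral_E:
  assumes "(x, y) \<in> spectral_integral E f" and A: "A \<in> sets borel"
  shows "(E A x, E A y) \<in> spectral_integral E f"
proof -
  obtain s where s: "\<And>n. simple_function borel (s n)"
    "(\<lambda>n. sqint (\<lambda>l. s n l - f l) x) \<longlonglongrightarrow> 0" "(\<lambda>n. S (s n) x) \<longlonglongrightarrow> y"
    by (rule spectral_integralE[OF assms(1)]) blast
  show ?thesis
  proof (rule spectral_integralI[OF _ s(1)])
    show "sqint f (E A x) < \<infinity>"
      by (rule le_less_trans[OF sqint_E_le[OF A] spectral_integral_finite[OF assms(1)]])
    show "(\<lambda>n. S (s n) (E A x)) \<longlonglongrightarrow> E A y"
      unfolding E_S[OF s(1) A, symmetric] by (rule bounded_linear.tendsto[OF bounded_linear_E[OF A] s(3)])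
    show "(\<lambda>n. sqint (\<lambda>l. s n l - f l) (E A x)) \<longlonglongrightarrow> 0"
      by (rule tendsto_0_le[OF sqint_E_le[OF A] s(2)])
  qed
qed

text \<open>Diagonal argument: replace each \<open>g n\<close> by a simple function within
  \<open>1 / Suc n\<close>, simultaneously in squared L^2 distance and in value.\<close>

lemma spectral_integral_closed:
  assumes [measurable]: "f \<in> borel_measurable borel" "\<And>n. g n \<in> borel_measurable borel"
    and "sqint f x < \<infinity>"
    and "\<And>n. (x, y n) \<in> spectral_integral E (g n)"
    and "(\<lambda>n. sqint (\<lambda>l. g n l - f l) x) \<longlonglongrightarrow> 0" "y \<longlonglongrightarrow> z"
  shows "(x, z) \<in> spectral_integral E f"
proof -
  have "\<forall>n. \<exists>s. simple_function borel s \<and> sqint (\<lambda>l. s l - g n l) x < ennreal (1 / Suc n)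
      \<and> norm (S s x - y n) < 1 / Suc n"
  proof
    fix n
    have "0 < 1 / real (Suc n)" by simp
    then show "\<exists>s. simple_function borel s \<and> sqint (\<lambda>l. s l - g n l) x < ennreal (1 / Suc n)
      \<and> norm (S s x - y n) < 1 / Suc n"
      using assms(4)[of n] unfolding spectral_integral_iff by blast
  qed
  from choice[OF this] obtain s where s: "\<And>n. simple_function borel (s n)"
      "\<And>n. sqint (\<lambda>l. s n l - g n l) x < ennreal (1 / Suc n)" "\<And>n. norm (S (s n) x - y n) < 1 / Suc n"
    by blast
  note [measurable] = borel_measurable_simple_function[OF s(1)]
  have lim: "(\<lambda>n. 1 / real (Suc n)) \<longlonglongrightarrow> 0"
    using LIMSEQ_Suc[OF lim_1_over_n] by simp
  show ?thesis
  proof (rule spectral_integralI[OF assms(3) s(1)])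
    have "(\<lambda>n. S (s n) x - y n) \<longlonglongrightarrow> 0"
      by (rule tendsto_norm_zero_cancel, rule tendsto_sandwich[OF _ _ tendsto_const lim])
        (simp_all add: less_imp_le[OF s(3)] always_eventually del: of_nat_Suc)
    from tendsto_add[OF this assms(6)] show "(\<lambda>n. S (s n) x) \<longlonglongrightarrow> z" by simp
    have "(\<lambda>n. sqint (\<lambda>l. s n l - g n l) x) \<longlonglongrightarrow> 0"
      by (rule tendsto_0_le[OF less_imp_le[OF s(2)]]) (use tendsto_ennrealI[OF lim] in simp)
    from tendsto_add[OF ennreal_2_mult_tendsto_0[OF this] ennreal_2_mult_tendsto_0[OF assms(5)]]
    have "(\<lambda>n. 2 * sqint (\<lambda>l. s n l - g n l) x + 2 * sqint (\<lambda>l. g n l - f l) x) \<longlonglongrightarrow> 0" by simp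
    then show "(\<lambda>n. sqint (\<lambda>l. s n l - f l) x) \<longlonglongrightarrow> 0"
      by (rule tendsto_0_le[rotated]) (rule sqint_triangle; measurable)
  qed
qed

text \<open>The sharp constant is 1; the factor 2 is harmless and avoids continuity of the \<open>L\<^sup>2\<close> norm.\<close>

lemma spectral_integral_norm_le:
  assumes "(x, y) \<in> spectral_integral E f" and [measurable]: "f \<in> borel_measurable borel"
  shows "ennreal ((norm y)\<^sup>2) \<le> 2 * sqint f x"
proof -
  obtain s where s: "\<And>n. simple_function borel (s n)"
    "(\<lambda>n. sqint (\<lambda>l. s n l - f l) x) \<longlonglongrightarrow> 0" "(\<lambda>n. S (s n) x) \<longlonglongrightarrow> y"
    by (rule spectral_integralE[OF assms(1)]) blast
  note [measurable] = borel_measurable_simple_function[OF s(1)]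
  have "(\<lambda>n. ennreal ((norm (S (s n) x))\<^sup>2)) \<longlonglongrightarrow> ennreal ((norm y)\<^sup>2)"
    by (intro tendsto_ennrealI tendsto_power tendsto_norm s)
  moreover have "(\<lambda>n. 2 * sqint (\<lambda>l. s n l - f l) x + 2 * sqint f x) \<longlonglongrightarrow> 2 * sqint f x"
    using tendsto_add[OF ennreal_2_mult_tendsto_0[OF s(2)] tendsto_const] by simp
  ultimately show ?thesis
  proof (rule LIMSEQ_le, intro exI[of _ 0] allI impI)
    fix n
    show "ennreal ((norm (S (s n) x))\<^sup>2) \<le> 2 * sqint (\<lambda>l. s n l - f l) x + 2 * sqint f x"
      using sqint_add_le[of "\<lambda>l. s n l - f l" f x] by (simp add: norm_S s(1))
  qed
qed

text \<open>A vector fixed by \<open>E K\<close> has no mass off \<open>K\<close>, so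
  \<open>f\<close> may be unbounded elsewhere.\<close>

lemma sqint_le_of_support:
  assumes K: "K \<in> sets borel" and x: "E K x = x" and f: "\<And>l. l \<in> K \<Longrightarrow> cmod (f l) \<le> c"
  shows "sqint f x \<le> ennreal ((c * norm x)\<^sup>2)"
proof -
  have "E (- K) x = E (- K) (E K x)" by (simp add: x)
  also have "\<dots> = 0" using K by (simp add: E_E)
  finally have "AE l in \<mu> x. l \<in> K"
    using K by (intro AE_I[of _ _ "- K"]) (auto simp: emeasure_vector_measure)
  then have "AE l in \<mu> x. ennreal ((cmod (f l))\<^sup>2) \<le> ennreal (c\<^sup>2)"
    by eventually_elim (auto intro!: ennreal_leI power_mono f)
  then have "sqint f x \<le> (\<integral>\<^sup>+ l. ennreal (c\<^sup>2) \<partial>\<mu> x)"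
    by (rule nn_integral_mono_AE)
  also have "\<dots> = ennreal ((c * norm x)\<^sup>2)"
    using emeasure_vector_measure[of UNIV x]
    by (simp add: ennreal_mult[symmetric] power_mult_distrib)
  finally show ?thesis .
qed

lemma norm_le_of_support:
  assumes "(x, y) \<in> spectral_integral E f" "f \<in> borel_measurable borel"
    and "K \<in> sets borel" "E K x = x" "\<And>l. l \<in> K \<Longrightarrow> cmod (f l) \<le> c" "c \<ge> 0"
  shows "norm y \<le> 2 * c * norm x"
proof -
  have "ennreal ((norm y)\<^sup>2) \<le> 2 * sqint f x"
    by (rule spectral_integral_norm_le[OF assms(1,2)])
  also have "\<dots> \<le> 2 * ennreal ((c * norm x)\<^sup>2)"
    by (intro mult_left_mono sqint_le_of_support[OF assms(3-5)]) simp_all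
  also have "\<dots> = ennreal (2 * (c * norm x)\<^sup>2)" by (simp add: ennreal_mult)
  finally have "(norm y)\<^sup>2 \<le> 2 * (c * norm x)\<^sup>2" by (simp add: ennreal_le_iff)
  \<comment> \<open>The factor 2 is enlarged to 4, a square, which keeps roots out of the
    constant.\<close>
  also have "\<dots> \<le> (2 * c * norm x)\<^sup>2" by (simp add: power_mult_distrib)
  finally show ?thesis
    by (rule power2_le_imp_le) (simp add: assms(6))
qed

end

section \<open>Spectral cutoffs\<close>

text \<open>The bound is uniform in \<open>l\<close> over the window, so
  \<open>norm_le_of_support\<close> can turn it into a bound on vectors.\<close>

lemma exp_taylor_remainder_le:
  fixes t l m :: real
  assumes "\<bar>l\<bar> \<le> m"
  shows "cmod (complex_of_real (exp (t * l)) - (\<Sum>k\<le>n. complex_of_real (t ^ k / fact k) * complex_of_real l ^ k))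
    \<le> exp (\<bar>t\<bar> * m) * (\<bar>t\<bar> * m) ^ Suc n / fact n"
proof -
  let ?z = "complex_of_real (t * l)"
  have le: "\<bar>t * l\<bar> \<le> \<bar>t\<bar> * m"
    unfolding abs_mult by (intro mult_left_mono assms) simp
  have "complex_of_real (exp (t * l)) - (\<Sum>k\<le>n. complex_of_real (t ^ k / fact k) * complex_of_real l ^ k)
      = exp ?z - (\<Sum>k\<le>n. ?z ^ k / fact k)"
    by (simp add: exp_of_real[symmetric] power_mult_distrib)
  also have "cmod \<dots> \<le> exp \<bar>Re ?z\<bar> * (cmod ?z) ^ Suc n / fact n"
    by (rule Taylor_exp)
  also have "\<dots> \<le> exp (\<bar>t\<bar> * m) * (\<bar>t\<bar> * m) ^ Suc n / fact n"
    unfolding norm_of_real Re_complex_of_real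
    by (intro divide_right_mono mult_mono power_mono) (use le in auto)
  finally show ?thesis .
qed

lemma exp_taylor_remainder_tendsto_0:
  "(\<lambda>n. a * c ^ Suc n / fact n) \<longlonglongrightarrow> (0::real)"
proof -
  have "(\<lambda>n. inverse (fact n) * c ^ n) \<longlonglongrightarrow> 0"
    using summable_LIMSEQ_zero[OF summable_exp[of c]] .
  from tendsto_mult_left[OF this, of "a * c"] show ?thesis
    by (simp add: field_simps)
qed

context pvm
begin

definition cutoff :: "nat \<Rightarrow> 'a \<Rightarrow> 'a" where "cutoff m = E {- real m..real m}"

lemma bounded_linear_cutoff: "bounded_linear (cutoff m)"
  unfolding cutoff_def by (rule bounded_linear_E) simp

lemma norm_cutoff_le: "norm (cutoff m x) \<le> norm x"
  unfolding cutoff_def by (rule norm_E_le) simp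

lemma cutoff_cutoff: "cutoff m (cutoff m x) = cutoff m x"
  unfolding cutoff_def by (rule E_idem) simp

text \<open>The complements of the windows decrease to the empty set, so their masses, which are the
  squared norms of the tails of \<open>x\<close>, tend to 0.\<close>

lemma cutoff_tendsto: "(\<lambda>m. cutoff m x) \<longlonglongrightarrow> x"
proof -
  let ?K = "\<lambda>m::nat. {- real m..real m}"
  have "(\<lambda>m. emeasure (\<mu> x) (- ?K m)) \<longlonglongrightarrow> emeasure (\<mu> x) (\<Inter>m. - ?K m)"
    by (intro Lim_emeasure_decseq) (auto simp: decseq_def emeasure_vector_measure)
  moreover have "(\<Inter>m. - ?K m) = {}"
  proof -
    have "\<exists>m. l \<in> ?K m" for l
      using real_arch_simple[of "\<bar>l\<bar>"] by (auto simp: abs_le_iff minus_le_iff)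
    then show ?thesis by blast
  qed
  ultimately have "(\<lambda>m. ennreal ((norm (E (- ?K m) x))\<^sup>2)) \<longlonglongrightarrow> 0"
    by (simp add: emeasure_vector_measure)
  then have "(\<lambda>m. (norm (E (- ?K m) x))\<^sup>2) \<longlonglongrightarrow> 0"
    by (simp add: tendsto_ennreal_iff[of _ _ 0, simplified])
  then have "(\<lambda>m. norm (E (- ?K m) x)) \<longlonglongrightarrow> 0"
    using tendsto_real_sqrt by fastforce
  then have "(\<lambda>m. E (- ?K m) x) \<longlonglongrightarrow> 0"
    by (rule tendsto_norm_zero_cancel)
  moreover have "E (- ?K m) x = x - cutoff m x" for m
  proof -
    have "x = cutoff m x + E (- ?K m) x"
      using E_Un[of "?K m" "- ?K m" x] by (simp add: cutoff_def)
    then show ?thesis by (metis add_diff_cancel_left')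
  qed
  ultimately have "(\<lambda>m. x - (x - cutoff m x)) \<longlonglongrightarrow> x - 0"
    by (intro tendsto_diff tendsto_const) simp
  then show ?thesis by simp
qed

lemma simple_approx_id:
  obtains g :: "nat \<Rightarrow> real \<Rightarrow> complex" where
    "\<And>n. simple_function borel (g n)"
    "\<And>n l. l \<in> {- real m..real m} \<Longrightarrow> cmod (g n l - complex_of_real l) \<le> 1 / Suc n"
proof -
  let ?K = "{- real m..real m}"
  \<comment> \<open>Rounding \<open>l\<close> down to a multiple of \<open>1 / Suc n\<close> costs
    at most one grid step; the value zero off the window keeps the range finite.\<close>
  let ?g = "\<lambda>n (l::real). if l \<in> ?K then complex_of_real (of_int \<lfloor>Suc n * l\<rfloor> / Suc n) else 0"
  have "simple_function borel (?g n)" for n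
  proof (rule simple_function_borel_measurable)
    have "range (?g n) \<subseteq> insert 0 ((\<lambda>i. complex_of_real (of_int i / Suc n)) `
        {\<lfloor>Suc n * - real m\<rfloor>..\<lfloor>Suc n * real m\<rfloor>})"
    proof
      fix w assume "w \<in> range (?g n)"
      then obtain l where w: "w = ?g n l" by blast
      show "w \<in> insert 0 ((\<lambda>i. complex_of_real (of_int i / Suc n)) `
        {\<lfloor>Suc n * - real m\<rfloor>..\<lfloor>Suc n * real m\<rfloor>})"
      proof (cases "l \<in> ?K")
        case True
        then have "\<lfloor>Suc n * l\<rfloor> \<in> {\<lfloor>Suc n * - real m\<rfloor>..\<lfloor>Suc n * real m\<rfloor>}"
          unfolding atLeastAtMost_iff by (intro conjI floor_mono mult_left_mono) auto
        with w True show ?thesis by (intro insertI2 image_eqI) simp_all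
      qed (use w in auto)
    qed
    then show "finite (?g n ` space borel)"
      unfolding space_borel by (rule finite_subset) (simp_all del: of_nat_Suc)

  qed measurable
  moreover have "cmod (?g n l - complex_of_real l) \<le> 1 / Suc n" if "l \<in> ?K" for n l
  proof -
    have "?g n l - complex_of_real l = complex_of_real (of_int \<lfloor>Suc n * l\<rfloor> / Suc n - l)"
      using that by simp
    then have "cmod (?g n l - complex_of_real l) = \<bar>(of_int \<lfloor>Suc n * l\<rfloor> - Suc n * l) / Suc n\<bar>"
      by (simp only: norm_of_real diff_divide_distrib) simp
    also have "\<dots> \<le> 1 / Suc n"
      unfolding abs_divide by (intro frac_le) linarith+
    finally show ?thesis .
  qed
  ultimately show thesis by (rule that)
qed

text \<open>Inserts one factor \<open>l\<close>. On the window \<open>l\<close> is a uniform limit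
  of simple functions, so their operators applied to \<open>y\<close> form a Cauchy sequence. Its
  limit \<open>z\<close> is at once the integral of the identity function at \<open>y\<close> and
  the integral of \<open>l * f l\<close> at \<open>x\<close>; this ties iteration of the operator to
  powers of the function.\<close>

lemma spectral_integral_step:
  fixes m :: nat
  assumes x: "cutoff m x = x" and y: "cutoff m y = y" and xy: "(x, y) \<in> spectral_integral E f"
    and [measurable]: "f \<in> borel_measurable borel"
    and f: "\<And>l. \<bar>l\<bar> \<le> real m \<Longrightarrow> cmod (f l) \<le> c" and c: "c \<ge> 0"
  obtains z where "cutoff m z = z" "(y, z) \<in> spectral_integral E complex_of_real"
    "(x, z) \<in> spectral_integral E (\<lambda>l. complex_of_real l * f l)"
proof -
  let ?K = "{- real m..real m}"
  obtain g where g: "\<And>n. simple_function borel (g n)"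
    "\<And>n l. l \<in> ?K \<Longrightarrow> cmod (g n l - complex_of_real l) \<le> 1 / Suc n"
    by (rule simple_approx_id[of m]) blast
  note [measurable] = borel_measurable_simple_function[OF g(1)]
  have lim: "(\<lambda>n. 1 / real (Suc n)) \<longlonglongrightarrow> 0"
    using LIMSEQ_Suc[OF lim_1_over_n] by simp
  have sq: "sqint h w \<le> ennreal ((a * norm w)\<^sup>2)" if "cutoff m w = w" "\<And>l. l \<in> ?K \<Longrightarrow> cmod (h l) \<le> a" for h w a
    by (rule sqint_le_of_support[OF _ that[unfolded cutoff_def]]) simp_all
  have "Cauchy (\<lambda>n. S (g n) y)"
  proof (rule metric_CauchyI)
    fix e :: real assume "e > 0"
    have "(\<lambda>n. 2 * (1 / real (Suc n)) * norm y) \<longlonglongrightarrow> 2 * 0 * norm y"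
      by (intro tendsto_intros lim)
    then have "eventually (\<lambda>n. 2 * (1 / real (Suc n)) * norm y < e) sequentially"
      using \<open>e > 0\<close> by (intro order_tendstoD) auto
    then obtain N where N: "2 * (1 / real (Suc N)) * norm y < e"
      by (auto dest: eventually_happens'[OF sequentially_bot])
    have "dist (S (g i) y) (S (g j) y) < e" if "i \<ge> N" "j \<ge> N" for i j
    proof -
      have "cmod (g i l - g j l) \<le> 2 * (1 / Suc N)" if l: "l \<in> ?K" for l
      proof -
        have "cmod (g i l - g j l) \<le> cmod (g i l - complex_of_real l) + cmod (g j l - complex_of_real l)"
          using norm_triangle_ineq4[of "g i l - complex_of_real l" "g j l - complex_of_real l"] by simp
        also have "\<dots> \<le> 1 / Suc i + 1 / Suc j" by (intro add_mono g(2) l)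
        also have "\<dots> \<le> 1 / Suc N + 1 / Suc N" using that \<open>i \<ge> N\<close> \<open>j \<ge> N\<close>
          by (intro add_mono frac_le) auto
        finally show ?thesis by simp
      qed
      then have "sqint (\<lambda>l. g i l - g j l) y \<le> ennreal ((2 * (1 / Suc N) * norm y)\<^sup>2)"
        by (rule sq[OF y])
      also have "sqint (\<lambda>l. g i l - g j l) y = ennreal ((norm (S (g i) y - S (g j) y))\<^sup>2)"
        by (simp add: norm_S[symmetric] simple_function_diff g(1) S_diff)
      finally have "(norm (S (g i) y - S (g j) y))\<^sup>2 \<le> (2 * (1 / Suc N) * norm y)\<^sup>2"
        by (subst (asm) ennreal_le_iff) simp_all
      then have "norm (S (g i) y - S (g j) y) \<le> 2 * (1 / Suc N) * norm y"
        by (rule power2_le_imp_le) simp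
      then show ?thesis using N by (simp add: dist_norm)
    qed
    then show "\<exists>M. \<forall>i\<ge>M. \<forall>j\<ge>M. dist (S (g i) y) (S (g j) y) < e" by blast
  qed
  then obtain z where z: "(\<lambda>n. S (g n) y) \<longlonglongrightarrow> z"
    using Cauchy_convergent convergent_def by blast
  show thesis
  proof (rule that[of z])
    \<comment> \<open>Each approximant is fixed by the cutoff, hence so is the limit; this makes the
      step repeatable.\<close>
    have "cutoff m (S (g n) y) = S (g n) y" for n
      unfolding cutoff_def by (subst E_S[OF g(1)]) (use y cutoff_def in simp_all)
    with bounded_linear.tendsto[OF bounded_linear_cutoff z, of m] z show "cutoff m z = z"
      using LIMSEQ_unique by auto
    have tend: "(\<lambda>n. ennreal ((1 / real (Suc n) * a)\<^sup>2)) \<longlonglongrightarrow> 0" for a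
    proof -
      have "(\<lambda>n. (1 / real (Suc n) * a)\<^sup>2) \<longlonglongrightarrow> (0 * a)\<^sup>2"
        by (intro tendsto_intros lim)
      then show ?thesis using tendsto_ennrealI by fastforce
    qed
    show "(y, z) \<in> spectral_integral E complex_of_real"
    proof (rule spectral_integralI[OF _ g(1) _ z])
      have "sqint complex_of_real y \<le> ennreal ((real m * norm y)\<^sup>2)"
        by (rule sq[OF y]) auto
      then show "sqint complex_of_real y < \<infinity>" by (auto intro: le_less_trans)
      show "(\<lambda>n. sqint (\<lambda>l. g n l - complex_of_real l) y) \<longlonglongrightarrow> 0"
        by (rule tendsto_0_le[OF sq[OF y g(2)] tend])
    qed
    show "(x, z) \<in> spectral_integral E (\<lambda>l. complex_of_real l * f l)"
    proof (rule spectral_integral_closed[where g="\<lambda>n l. g n l * f l", OF _ _ _ _ _ z])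
      have "sqint (\<lambda>l. complex_of_real l * f l) x \<le> ennreal ((real m * c * norm x)\<^sup>2)"
        by (rule sq[OF x]) (auto simp: norm_mult intro!: mult_mono f)
      then show "sqint (\<lambda>l. complex_of_real l * f l) x < \<infinity>" by (auto intro: le_less_trans)
      show "(x, S (g n) y) \<in> spectral_integral E (\<lambda>l. g n l * f l)" for n
        by (rule spectral_integral_mult_simple[OF xy _ g(1)]) measurable
      have "sqint (\<lambda>l. g n l * f l - complex_of_real l * f l) x \<le> ennreal ((1 / Suc n * c * norm x)\<^sup>2)" for n
      proof (rule sq[OF x])
        fix l assume l: "l \<in> ?K"
        have "cmod (g n l * f l - complex_of_real l * f l) = cmod (g n l - complex_of_real l) * cmod (f l)"
          by (metis left_diff_distrib norm_mult)
        also have "\<dots> \<le> 1 / Suc n * c"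
          using l by (intro mult_mono g(2) f) auto
        finally show "cmod (g n l * f l - complex_of_real l * f l) \<le> 1 / Suc n * c" .
      qed
      then show "(\<lambda>n. sqint (\<lambda>l. g n l * f l - complex_of_real l * f l) x) \<longlonglongrightarrow> 0"
        by (rule tendsto_0_le) (use tend[of "c * norm x"] in \<open>simp add: mult.assoc\<close>)
    qed measurable
  qed
qed

lemma spectral_integral_powers:
  fixes m :: nat
  assumes x: "cutoff m x = x"
  obtains Y where "Y 0 = x" "\<And>k. (Y k, Y (Suc k)) \<in> spectral_integral E complex_of_real"
    "\<And>k. (x, Y k) \<in> spectral_integral E (\<lambda>l. complex_of_real l ^ k)"
proof -
  \<comment> \<open>The clause for \<open>k = 0\<close> pins the starting vector in the dependent
    choice; invariance under the cutoff is carried along because each step requires it.\<close>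
  define Q where "Q k y \<longleftrightarrow> (k = 0 \<longrightarrow> y = x) \<and> cutoff m y = y \<and> (x, y) \<in> spectral_integral E (\<lambda>l. complex_of_real l ^ k)" for k y
  have "S (\<lambda>_. 1) x = x"
    by (simp add: simple_spectral_integral_def)
  then have "(x, x) \<in> spectral_integral E (\<lambda>l. 1)"
    using sqint_le_of_support[of UNIV x "\<lambda>_. 1" 1]
    by (intro spectral_integralI[where s="\<lambda>_ _. 1"]) (auto intro: le_less_trans)
  then have 0: "Q 0 x" using x by (simp add: Q_def)
  have "\<exists>z. Q (Suc k) z \<and> (y, z) \<in> spectral_integral E complex_of_real" if "Q k y" for k y
  proof -
    have bound: "\<bar>l\<bar> \<le> real m \<Longrightarrow> cmod (complex_of_real l ^ k) \<le> real m ^ k" for l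
      by (simp add: norm_power power_mono)
    have "cutoff m y = y" "(x, y) \<in> spectral_integral E (\<lambda>l. complex_of_real l ^ k)"
      using that unfolding Q_def by auto
    then obtain z where "cutoff m z = z" "(y, z) \<in> spectral_integral E complex_of_real"
      "(x, z) \<in> spectral_integral E (\<lambda>l. complex_of_real l * complex_of_real l ^ k)"
      by (rule spectral_integral_step[OF x _ _ _ bound]) simp_all
    then show ?thesis unfolding Q_def by auto
  qed
  then obtain Y where "\<And>k. Q k (Y k)" "\<And>k. (Y k, Y (Suc k)) \<in> spectral_integral E complex_of_real"
    using dependent_nat_choice[of Q "\<lambda>k y z. (y, z) \<in> spectral_integral E complex_of_real"] 0 by blast
  then show thesis by (intro that[of Y]) (auto simp: Q_def)
qed

end

context pvm
begin

text \<open>Projections commute with spectral integrals, so \<open>cutoff m y\<close> is the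
  exponential evaluated at \<open>cutoff m v\<close>. On the window the Taylor polynomials converge
  uniformly, hence the partial sums converge in norm.\<close>

lemma exp_cutoff_sums:
  fixes m :: nat
  assumes vy: "(v, y) \<in> spectral_integral E (\<lambda>l. complex_of_real (exp (t * l)))"
    and Y: "\<And>k. (cutoff m v, Y k) \<in> spectral_integral E (\<lambda>l. complex_of_real l ^ k)"
  shows "(\<lambda>k. (t ^ k / fact k) *\<^sub>R Y k) sums cutoff m y"
proof -
  let ?x = "cutoff m v"
  let ?p = "\<lambda>n l. \<Sum>k\<le>n. complex_of_real (t ^ k / fact k) * complex_of_real l ^ k"
  have xy: "(?x, cutoff m y) \<in> spectral_integral E (\<lambda>l. complex_of_real (exp (t * l)))"
    unfolding cutoff_def by (rule spectral_integral_E[OF vy]) simp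
  have poly: "(?x, \<Sum>k\<le>n. (t ^ k / fact k) *\<^sub>R Y k) \<in> spectral_integral E (?p n)" for n
  proof (induction n)
    case 0
    then show ?case using Y[of 0] by simp
  next
    case (Suc n)
    have "(?x, complex_of_real (t ^ Suc n / fact (Suc n)) *\<^sub>C Y (Suc n))
        \<in> spectral_integral E (\<lambda>l. complex_of_real (t ^ Suc n / fact (Suc n)) * complex_of_real l ^ Suc n)"
      by (rule spectral_integral_scaleC[OF Y]) measurable
    from spectral_integral_add[OF Suc.IH this] show ?case
      unfolding scaleC_of_real sum.atMost_Suc by measurable
  qed
  have "norm (cutoff m y - (\<Sum>k\<le>n. (t ^ k / fact k) *\<^sub>R Y k))
      \<le> 2 * (exp (\<bar>t\<bar> * m) * (\<bar>t\<bar> * m) ^ Suc n / fact n) * norm ?x" for n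
  proof (rule norm_le_of_support)
    have "(?x, (-1) *\<^sub>C (\<Sum>k\<le>n. (t ^ k / fact k) *\<^sub>R Y k)) \<in> spectral_integral E (\<lambda>l. (-1) * ?p n l)"
      by (rule spectral_integral_scaleC[OF poly]) measurable
    from spectral_integral_add[OF xy this]
    show "(?x, cutoff m y - (\<Sum>k\<le>n. (t ^ k / fact k) *\<^sub>R Y k))
        \<in> spectral_integral E (\<lambda>l. complex_of_real (exp (t * l)) - ?p n l)"
      by (simp add: scaleC_minus_one)
    show "E {- real m..real m} ?x = ?x" using cutoff_cutoff[of m v] by (simp add: cutoff_def)
    show "cmod (complex_of_real (exp (t * l)) - ?p n l) \<le> exp (\<bar>t\<bar> * m) * (\<bar>t\<bar> * m) ^ Suc n / fact n"
      if "l \<in> {- real m..real m}" for l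
      by (rule exp_taylor_remainder_le) (use that in auto)
    show "{- real m..real m} \<in> sets borel" by simp
  qed simp_all
  moreover have "(\<lambda>n. 2 * (exp (\<bar>t\<bar> * m) * (\<bar>t\<bar> * m) ^ Suc n / fact n) * norm ?x) \<longlonglongrightarrow> 0"
    using tendsto_mult[OF tendsto_mult[OF tendsto_const exp_taylor_remainder_tendsto_0] tendsto_const, of 2]
    by fastforce
  ultimately have "(\<lambda>n. cutoff m y - (\<Sum>k\<le>n. (t ^ k / fact k) *\<^sub>R Y k)) \<longlonglongrightarrow> 0"
    by (rule Lim_null_comparison[OF always_eventually[OF allI]])
  then have "(\<lambda>n. cutoff m y - (cutoff m y - (\<Sum>k\<le>n. (t ^ k / fact k) *\<^sub>R Y k))) \<longlonglongrightarrow> cutoff m y - 0"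
    by (intro tendsto_diff tendsto_const)
  then show ?thesis by (simp add: sums_def_le)
qed

lemma norm_le_of_cutoff:
  assumes "(x, y) \<in> spectral_integral E complex_of_real" "cutoff m x = x"
  shows "norm y \<le> 2 * real m * norm x"
  by (rule norm_le_of_support[OF assms(1) _ _ assms(2)[unfolded cutoff_def]]) auto

lemma cutoff_mem:
  assumes "(x, y) \<in> spectral_integral E f"
  shows "(cutoff m x, cutoff m y) \<in> spectral_integral E f"
  unfolding cutoff_def by (rule spectral_integral_E[OF assms]) simp

end

section \<open>Orbits of bounded vectors\<close>

text \<open>A sequence rather than iterates of a function: \<open>H\<close> is a relation,
  membership records that every term lies in the domain, and each shift is again an orbit.\<close>

definition power_orbit :: "'a operator \<Rightarrow> (nat \<Rightarrow> 'a) \<Rightarrow> bool" where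
  "power_orbit T U \<longleftrightarrow> (\<forall>k. (U k, U (Suc k)) \<in> T)"

text \<open>Geometric growth expresses spectral boundedness without a spectral measure, and it makes
  the exponential series converge for every \<open>t\<close>.\<close>

definition bounded_orbit :: "'a::real_normed_vector operator \<Rightarrow> (nat \<Rightarrow> 'a) \<Rightarrow> bool" where
  "bounded_orbit T U \<longleftrightarrow> power_orbit T U \<and> (\<exists>M r. 0 \<le> r \<and> (\<forall>k. norm (U k) \<le> M * r ^ k))"

lemma bounded_orbitE:
  assumes "bounded_orbit T U"
  obtains M r where "M \<ge> 0" "r \<ge> 0" "\<And>k. norm (U k) \<le> M * r ^ k"
proof -
  obtain M r where "0 \<le> r" "\<And>k. norm (U k) \<le> M * r ^ k"
    using assms unfolding bounded_orbit_def by blast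
  moreover have "0 \<le> M" using order_trans[OF norm_ge_zero calculation(2)[of 0]] by simp
  ultimately show thesis using that by blast
qed

lemma bounded_orbit_shift:
  assumes "bounded_orbit T U"
  shows "bounded_orbit T (\<lambda>k. U (Suc k))"
proof -
  obtain M r where "r \<ge> 0" "\<And>k. norm (U k) \<le> M * r ^ k"
    using bounded_orbitE[OF assms] by metis
  then have "0 \<le> r \<and> (\<forall>k. norm (U (Suc k)) \<le> (M * r) * r ^ k)"
    using mult.assoc by (metis power_Suc)
  then show ?thesis
    using assms unfolding bounded_orbit_def power_orbit_def by blast
qed

locale spectral_op = pvm E for E :: "real set \<Rightarrow> 'a::complex_hilbert \<Rightarrow> 'a" +
  fixes H :: "'a operator"
  assumes H: "H = spectral_integral E complex_of_real"
begin

text \<open>The cutoff commutes with \<open>H\<close>, and on its range \<open>H\<close> is bounded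
  by \<open>2 * real m\<close>. This truncates the orbit of a smooth vector term by term.\<close>

lemma bounded_orbit_cutoff:
  assumes "power_orbit H U"
  shows "bounded_orbit H (\<lambda>k. cutoff m (U k))"
  unfolding bounded_orbit_def
proof (intro conjI exI allI)
  have *: "(U k, U (Suc k)) \<in> spectral_integral E complex_of_real" for k
    using assms by (simp add: power_orbit_def H)
  show "power_orbit H (\<lambda>k. cutoff m (U k))"
    unfolding power_orbit_def H using cutoff_mem[OF *] by blast
  show "norm (cutoff m (U k)) \<le> norm (U 0) * (2 * real m) ^ k" for k
  proof (induction k)
    case (Suc k)
    have "norm (cutoff m (U (Suc k))) \<le> 2 * real m * norm (cutoff m (U k))"
      by (rule norm_le_of_cutoff[OF cutoff_mem[OF *] cutoff_cutoff])
    also have "\<dots> \<le> 2 * real m * (norm (U 0) * (2 * real m) ^ k)"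
      by (intro mult_left_mono Suc) simp
    finally show ?case by (simp add: mult_ac)
  qed (simp add: norm_cutoff_le)
qed simp

text \<open>In contrast to truncating a given orbit, this starts from an arbitrary \<open>x\<close>,
  smooth or not. Hence the starting points of bounded orbits are dense.\<close>

lemma cutoff_orbit:
  obtains Y where "bounded_orbit H Y" "Y 0 = cutoff m x"
    "\<And>k. (cutoff m x, Y k) \<in> spectral_integral E (\<lambda>l. complex_of_real l ^ k)"
proof -
  obtain Y where Y: "Y 0 = cutoff m x" "\<And>k. (Y k, Y (Suc k)) \<in> spectral_integral E complex_of_real"
    "\<And>k. (cutoff m x, Y k) \<in> spectral_integral E (\<lambda>l. complex_of_real l ^ k)"
    by (rule spectral_integral_powers[OF cutoff_cutoff]) blast
  show thesis
  proof (rule that[OF _ Y(1,3)])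
    have "norm (Y k) \<le> (2 * norm (cutoff m x)) * real m ^ k" for k
    proof -
      have "norm (Y k) \<le> 2 * real m ^ k * norm (cutoff m x)"
      proof (rule norm_le_of_support[OF Y(3)])
        show "E {- real m..real m} (cutoff m x) = cutoff m x" using cutoff_cutoff[of m x] by (simp add: cutoff_def)
        show "cmod (complex_of_real l ^ k) \<le> real m ^ k" if "l \<in> {- real m..real m}" for l
          unfolding norm_power norm_of_real by (intro power_mono) (use that in auto)
        show "{- real m..real m} \<in> sets borel" by simp
      qed simp_all
      then show ?thesis by (simp add: mult_ac)
    qed
    then show "bounded_orbit H Y"
      unfolding bounded_orbit_def power_orbit_def H using Y(2) by (metis of_nat_0_le_iff)
  qed
qed

text \<open>The orbit \<open>U\<close> has no relation to \<open>E\<close>. For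
  \<open>cutoff m v\<close> the exponential is a series in an orbit of that vector, and symmetry
  moves all powers of \<open>H\<close> onto \<open>U\<close>. Geometric growth of \<open>U\<close>
  makes the series a bounded functional of the right argument, so \<open>m\<close> can tend to
  infinity.\<close>

lemma cinner_exp_sums:
  assumes sym: "\<And>x y x' y'. (x, y) \<in> H \<Longrightarrow> (x', y') \<in> H \<Longrightarrow> cinner x y' = cinner y x'"
    and vy: "(v, y) \<in> spectral_integral E (\<lambda>l. complex_of_real (exp (t * l)))"
    and U: "bounded_orbit H U"
  shows "(\<lambda>k. complex_of_real (t ^ k / fact k) * cinner (U k) v) sums cinner (U 0) y"
proof -
  obtain M r where Mr: "M \<ge> 0" "r \<ge> 0" "\<And>k. norm (U k) \<le> M * r ^ k"
    using bounded_orbitE[OF U] by metis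
  let ?f = "\<lambda>w k. complex_of_real (t ^ k / fact k) * cinner (U k) w"
  have le: "cmod (?f w k) \<le> (M * norm w) * (inverse (fact k) * (\<bar>t\<bar> * r) ^ k)" for w k
  proof -
    have "cmod (?f w k) \<le> \<bar>t\<bar> ^ k / fact k * (norm (U k) * norm w)"
      unfolding norm_mult norm_of_real
      by (intro mult_mono cmod_cinner_le) (simp_all add: power_abs)
    also have "\<dots> \<le> \<bar>t\<bar> ^ k / fact k * (M * r ^ k * norm w)"
      by (intro mult_left_mono mult_right_mono Mr) simp_all
    finally show ?thesis by (simp add: field_simps power_mult_distrib)
  qed
  have sm: "summable (\<lambda>k. (M * norm w) * (inverse (fact k) * (\<bar>t\<bar> * r) ^ k))" for w
    by (intro summable_mult summable_exp)
  have summable: "summable (?f w)" for w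
    by (rule summable_comparison_test'[OF sm le])
  have bnd: "cmod (suminf (?f w)) \<le> (M * exp (\<bar>t\<bar> * r)) * norm w" for w
  proof -
    have "cmod (suminf (?f w)) \<le> (\<Sum>k. (M * norm w) * (inverse (fact k) * (\<bar>t\<bar> * r) ^ k))"
      by (rule norm_suminf_le[OF le sm])
    also have "\<dots> = (M * norm w) * exp (\<bar>t\<bar> * r)"
      by (subst suminf_mult[OF summable_exp]) (simp add: exp_def divide_inverse mult.commute)
    finally show ?thesis by (simp add: mult_ac)
  qed
  have P: "suminf (?f (cutoff m v)) = cinner (U 0) (cutoff m y)" for m
  proof -
    obtain Y where Y: "bounded_orbit H Y" "Y 0 = cutoff m v"
      "\<And>k. (cutoff m v, Y k) \<in> spectral_integral E (\<lambda>l. complex_of_real l ^ k)"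
      by (rule cutoff_orbit) blast
    have mv: "cinner (U k) (Y j) = cinner (U (k + j)) (Y 0)" for k j
    proof (induction j arbitrary: k)
      case (Suc j)
      have "cinner (U k) (Y (Suc j)) = cinner (U (Suc k)) (Y j)"
        by (rule sym) (use U Y(1) in \<open>auto simp: bounded_orbit_def power_orbit_def\<close>)
      then show ?case using Suc[of "Suc k"] by simp
    qed simp
    have "(\<lambda>k. cinner (U 0) ((t ^ k / fact k) *\<^sub>R Y k)) sums cinner (U 0) (cutoff m y)"
      by (rule bounded_linear.sums[OF bounded_linear_cinner_right exp_cutoff_sums[OF vy Y(3)]])
    then show ?thesis
      by (simp add: cinner_scaleR_right scaleR_conv_of_real mv Y(2) sums_iff)
  qed
  have "(\<lambda>m. suminf (?f (cutoff m v))) \<longlonglongrightarrow> suminf (?f v)"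
  proof (rule LIM_zero_cancel, rule tendsto_norm_zero_cancel, rule tendsto_sandwich[OF _ _ tendsto_const])
    have "suminf (?f (cutoff m v)) - suminf (?f v) = suminf (?f (cutoff m v - v))" for m
      unfolding suminf_diff[OF summable summable] by (simp only: cinner_diff_right right_diff_distrib)
    then show "\<forall>\<^sub>F m in sequentially. cmod (suminf (?f (cutoff m v)) - suminf (?f v))
        \<le> (M * exp (\<bar>t\<bar> * r)) * norm (cutoff m v - v)"
      using bnd by simp
    have "(\<lambda>m. (M * exp (\<bar>t\<bar> * r)) * norm (cutoff m v - v)) \<longlonglongrightarrow> (M * exp (\<bar>t\<bar> * r)) * norm (v - v)"
      by (intro tendsto_intros cutoff_tendsto)
    then show "(\<lambda>m. (M * exp (\<bar>t\<bar> * r)) * norm (cutoff m v - v)) \<longlonglongrightarrow> 0" by simp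
  qed simp
  moreover have "(\<lambda>m. cinner (U 0) (cutoff m y)) \<longlonglongrightarrow> cinner (U 0) y"
    by (rule bounded_linear.tendsto[OF bounded_linear_cinner_right cutoff_tendsto])
  ultimately have "suminf (?f v) = cinner (U 0) y"
    unfolding P by (rule LIMSEQ_unique)
  then show ?thesis using summable[of v] by (simp add: sums_iff)
qed

end

section \<open>Independence of the exponential from the choice of spectral measure\<close>

lemma selfadjoint_op_symmetric:
  assumes "selfadjoint_op H" "(x, y) \<in> H" "(x', y') \<in> H"
  shows "cinner x y' = cinner y x'"
proof -
  have "(x, y) \<in> adjoint_op H" using assms by (simp add: selfadjoint_op_def)
  then show ?thesis using assms(3) unfolding adjoint_op_def by auto
qed

lemma exp_opE:
  assumes "(v, y) \<in> exp_op t H"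
  obtains E where "spectral_op E H" "(v, y) \<in> spectral_integral E (\<lambda>l. complex_of_real (exp (t * l)))"
  using assms unfolding exp_op_def functional_calculus_def spectral_measure_of_def
  by (auto simp: spectral_op_def spectral_op_axioms_def pvm_def)

text \<open>The spectral measure vanishes from the statement, so formulas for different
  \<open>t\<close>, or for different witnesses at one \<open>t\<close>, become comparable.\<close>

lemma cinner_exp_op_sums:
  assumes "selfadjoint_op H" "(v, y) \<in> exp_op t H" "bounded_orbit H U"
  shows "(\<lambda>k. complex_of_real (t ^ k / fact k) * cinner (U k) v) sums cinner (U 0) y"
proof -
  obtain E where "spectral_op E H" "(v, y) \<in> spectral_integral E (\<lambda>l. complex_of_real (exp (t * l)))"
    using exp_opE[OF assms(2)] .
  then show ?thesis
    using spectral_op.cinner_exp_sums selfadjoint_op_symmetric[OF assms(1)] assms(3) by blast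
qed

text \<open>The two values may come from different spectral measures, yet both have the same series
  against every bounded orbit. Orbits starting at cutoffs of \<open>y - z\<close> approximate this
  difference, which is therefore orthogonal to itself.\<close>

lemma exp_op_single_valued:
  assumes "selfadjoint_op H" "(v, y) \<in> exp_op t H" "(v, z) \<in> exp_op t H"
  shows "y = z"
proof -
  obtain E where "spectral_op E H" using exp_opE[OF assms(2)] .
  then interpret spectral_op E H .
  have "cinner (cutoff m (y - z)) (y - z) = 0" for m
  proof -
    obtain Y where Y: "bounded_orbit H Y" "Y 0 = cutoff m (y - z)" by (rule cutoff_orbit) blast
    have "cinner (Y 0) y = cinner (Y 0) z"
      using cinner_exp_op_sums[OF assms(1,2) Y(1)] cinner_exp_op_sums[OF assms(1,3) Y(1)]
      by (rule sums_unique2)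
    then show ?thesis by (simp add: Y(2) cinner_diff_right)
  qed
  then have "cinner (y - z) (y - z) = 0"
    using bounded_linear.tendsto[OF bounded_linear_cinner_left cutoff_tendsto, of "y - z" "y - z"]
    by (simp add: LIMSEQ_const_iff)
  then show ?thesis by (simp add: cinner_self)
qed

lemma op_apply_exp_op:
  assumes "selfadjoint_op H" "v \<in> Domain (exp_op t H)"
  shows "(v, op_apply (exp_op t H) v) \<in> exp_op t H"
proof -
  obtain y where y: "(v, y) \<in> exp_op t H" using assms(2) by blast
  show ?thesis
    unfolding op_apply_def using y exp_op_single_valued[OF assms(1) _ y] by (rule theI[of "\<lambda>y. (v, y) \<in> exp_op t H"])
qed

section \<open>Chains of derivatives with a power singularity\<close>

text \<open>All derivatives form one family because the induction on the singularity passes from a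
  chain to its shift. At 0 the derivative is one-sided, as the data live on
  \<open>{0..<b}\<close>.\<close>

definition derivative_chain :: "real \<Rightarrow> (nat \<Rightarrow> real \<Rightarrow> complex) \<Rightarrow> bool" where
  "derivative_chain b F \<longleftrightarrow>
     (\<forall>k. \<forall>t\<in>{0..<b}. (F k has_vector_derivative F (Suc k) t) (at t within {0..<b}))"

lemma derivative_chain_shift: "derivative_chain b F \<Longrightarrow> derivative_chain b (\<lambda>k. F (Suc k))"
  unfolding derivative_chain_def by blast

text \<open>A mean value inequality against a real majorant takes the place of integrating the
  bound.\<close>

lemma derivative_chain_growth:
  assumes F: "derivative_chain b F" and st: "0 \<le> s" "s \<le> t" "t < b"
    and \<phi>: "\<And>x. 0 \<le> x \<Longrightarrow> x < b \<Longrightarrow> (\<phi> has_real_derivative \<phi>' x) (at x)"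
    and le: "\<And>x. 0 \<le> x \<Longrightarrow> x < b \<Longrightarrow> cmod (F 1 x) \<le> \<phi>' x"
  shows "cmod (F 0 t - F 0 s) \<le> \<phi> t - \<phi> s"
proof (cases "s = t")
  case False
  have D: "(F 0 has_vector_derivative F 1 x) (at x within {0..<b})" if "x \<in> {0..<b}" for x
    using F that unfolding derivative_chain_def by simp
  show ?thesis
  proof (rule differentiable_bound_general)
    show "s < t" using st False by simp
    show "continuous_on {s..t} (F 0)"
      using st by (intro continuous_on_vector_derivative[of _ _ "F 1"]
          has_vector_derivative_within_subset[OF D]) auto
    show "continuous_on {s..t} \<phi>"
      using st by (intro continuous_at_imp_continuous_on ballI DERIV_isCont[OF \<phi>]) auto
    show "(F 0 has_vector_derivative F 1 x) (at x)" if "s < x" "x < t" for x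
    proof -
      have "at x within {0..<b} = at x"
        by (rule at_within_nhd[of _ "{0<..<b}"]) (use that st in auto)
      then show ?thesis using D[of x] that st by simp
    qed
    show "(\<phi> has_vector_derivative \<phi>' x) (at x)" if "s < x" "x < t" for x
      using \<phi>[of x] that st by (simp add: has_real_derivative_iff_has_vector_derivative)
    show "norm (F 1 x) \<le> \<phi>' x" if "s < x" "x < t" for x
      using le[of x] that st by simp
  qed
qed simp

text \<open>Each integration improves the exponent of the singularity by 1; starting from exponents in
  \<open>\<nat> + 1/2\<close> avoids logarithms.\<close>

lemma derivative_chain_lower_order:
  assumes "b > 0"
  shows "p \<ge> real j + 1/2 \<Longrightarrow> \<exists>D\<ge>0. \<forall>F A. derivative_chain b F \<longrightarrow>
    (\<forall>k. \<forall>t\<in>{0..<b}. cmod (F k t) \<le> A k * (b - t) powr - p) \<longrightarrow>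
    (\<forall>t\<in>{0..<b}. cmod (F 0 t) \<le> D * (\<Sum>k\<le>j. A k) * (b - t) powr (real j - p))"
proof (induction j)
  case 0
  show ?case by (intro exI[of _ 1]) auto
next
  case (Suc j)
  \<comment> \<open>\<open>D\<close> depends on neither the chain nor \<open>A\<close>, so the
    induction hypothesis applies to the shifted chain.\<close>
  then obtain D where D: "D \<ge> 0" "\<And>F A t. derivative_chain b F \<Longrightarrow>
    (\<forall>k. \<forall>t\<in>{0..<b}. cmod (F k t) \<le> A k * (b - t) powr - p) \<Longrightarrow> t \<in> {0..<b} \<Longrightarrow>
    cmod (F 0 t) \<le> D * (\<Sum>k\<le>j. A k) * (b - t) powr (real j - p)"
    by force
  define r where "r = real (Suc j) - p"
  have r: "r \<le> - 1/2" using Suc.prems by (simp add: r_def)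
  show ?case
  \<comment> \<open>The first summand pays for \<open>F 0 0\<close>: since \<open>r < 0\<close>,
    \<open>b powr r\<close> is at most \<open>(b - t) powr r\<close>. The second comes from the
    derivative: its primitive carries a factor \<open>1 / (- r)\<close>, which is at most 2.\<close>
  proof (intro exI[of _ "b powr (- p - r) + 2 * D"] conjI allI impI ballI)
    fix F A t
    assume F: "derivative_chain b F"
      and A: "\<forall>k. \<forall>t\<in>{0..<b}. cmod (F k t) \<le> A k * (b - t) powr - p" and t: "t \<in> {0..<b}"
    define R where "R = (\<Sum>k\<le>Suc j. A k)"
    \<comment> \<open>The assumed bound at 0 forces nonnegative constants, so partial sums may be
      enlarged.\<close>
    have A0: "A k \<ge> 0" for k
    proof -
      have "0 \<le> A k * b powr - p" using A[rule_format, of 0 k] assms order_trans[OF norm_ge_zero] by simp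
      then show ?thesis using assms by (simp add: zero_le_mult_iff)
    qed
    then have R: "A 0 \<le> R" "(\<Sum>k\<le>j. A (Suc k)) \<le> R" "R \<ge> 0"
      unfolding R_def by (auto simp: sum.atMost_Suc_shift sum_nonneg simp del: sum.atMost_Suc)
    let ?\<phi> = "\<lambda>x. 2 * D * R * (b - x) powr r"
    have "cmod (F 0 t - F 0 0) \<le> ?\<phi> t - ?\<phi> 0"
    proof (rule derivative_chain_growth[OF F])
      fix x assume x: "0 \<le> x" "x < b"
      show "(?\<phi> has_real_derivative 2 * D * R * (- r * (b - x) powr (r - 1))) (at x)"
        using x by (auto intro!: derivative_eq_intros)
      have "cmod (F 1 x) \<le> D * (\<Sum>k\<le>j. A (Suc k)) * (b - x) powr (real j - p)"
        using D(2)[OF derivative_chain_shift[OF F], of "\<lambda>k. A (Suc k)" x] A x by auto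
      also have "\<dots> \<le> D * R * (b - x) powr (r - 1)"
        using R D(1) by (auto simp: r_def intro!: mult_right_mono mult_left_mono)
      also have "\<dots> \<le> (2 * (- r)) * (D * R * (b - x) powr (r - 1))"
        using r R D(1) by (intro mult_right_mono[of 1 _ "D * R * (b - x) powr (r - 1)", simplified mult_1]) auto
      finally show "cmod (F 1 x) \<le> 2 * D * R * (- r * (b - x) powr (r - 1))"
        by (simp add: mult_ac)
    qed (use t in auto)
    moreover have "cmod (F 0 0) \<le> R * (b powr (- p - r) * (b - t) powr r)"
    proof -
      have "cmod (F 0 0) \<le> A 0 * b powr - p" using A[rule_format, of 0 0] assms by simp
      also have "\<dots> \<le> R * b powr - p" using R by (intro mult_right_mono) auto
      also have "b powr - p = b powr (- p - r) * b powr r" by (simp add: powr_add[symmetric])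
      also have "R * (b powr (- p - r) * b powr r) \<le> R * (b powr (- p - r) * (b - t) powr r)"
        using t r R by (intro mult_left_mono powr_mono2') auto
      finally show ?thesis .
    qed
    moreover have "?\<phi> 0 \<ge> 0" using D(1) R by simp
    moreover have "cmod (F 0 t) \<le> cmod (F 0 0) + cmod (F 0 t - F 0 0)"
      using norm_triangle_sub[of "F 0 t" "F 0 0"] by simp
    ultimately show "cmod (F 0 t)
        \<le> (b powr (- p - r) + 2 * D) * (\<Sum>k\<le>Suc j. A k) * (b - t) powr (real (Suc j) - p)"
      unfolding R_def[symmetric] r_def[symmetric] by (simp add: algebra_simps)
  qed (use D(1) in simp)
qed

text \<open>One more integration after the exponent has reached \<open>- 1/2\<close>: this
  singularity is integrable, with a multiple of \<open>sqrt (b - t)\<close> as primitive.\<close>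

lemma derivative_chain_modulus:
  assumes "b > 0"
  obtains D K where "D \<ge> 0" "\<And>F A s t. derivative_chain b F \<Longrightarrow>
    (\<And>k t. t \<in> {0..<b} \<Longrightarrow> cmod (F k t) \<le> A k / (b - t) powr N) \<Longrightarrow>
    s \<in> {0..<b} \<Longrightarrow> t \<in> {0..<b} \<Longrightarrow>
    cmod (F 0 t - F 0 s) \<le> D * (\<Sum>k\<le>K::nat. A k) * \<bar>sqrt (b - t) - sqrt (b - s)\<bar>"
proof -
  \<comment> \<open>Chosen so that \<open>j\<close> integrations starting from the exponent
    \<open>- p\<close> leave exactly \<open>- 1/2\<close>.\<close>
  define j where "j = nat \<lceil>N\<rceil>"
  define p where "p = real j + 1/2"
  have pN: "N \<le> p" unfolding p_def j_def by linarith
  obtain D where D: "D \<ge> 0" "\<And>F A t. derivative_chain b F \<Longrightarrow>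
    (\<forall>k. \<forall>t\<in>{0..<b}. cmod (F k t) \<le> A k * (b - t) powr - p) \<Longrightarrow> t \<in> {0..<b} \<Longrightarrow>
    cmod (F 0 t) \<le> D * (\<Sum>k\<le>j. A k) * (b - t) powr (real j - p)"
    using derivative_chain_lower_order[OF assms, of j p] unfolding p_def by auto
  \<comment> \<open>The price of raising the exponent from \<open>N\<close> to \<open>p\<close>: an
    upper bound for \<open>(b - x) powr (p - N)\<close> on the interval.\<close>
  define B where "B = b powr (p - N)"
  have B: "B \<ge> 0" by (simp add: B_def)
  have main: "cmod (F 0 t - F 0 s) \<le> (2 * D * B) * (\<Sum>k\<le>Suc j. A k) * (sqrt (b - s) - sqrt (b - t))"
    if F: "derivative_chain b F"
      and A: "\<And>k t. t \<in> {0..<b} \<Longrightarrow> cmod (F k t) \<le> A k / (b - t) powr N"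
      and st: "0 \<le> s" "s \<le> t" "t < b" for F A s t
  proof -
    have A0: "A k \<ge> 0" for k
    proof -
      have "0 \<le> A k / b powr N" using A[of 0 k] assms order_trans[OF norm_ge_zero] by simp
      then show ?thesis using assms by (simp add: zero_le_divide_iff)
    qed
    define R where "R = (\<Sum>k\<le>Suc j. A k)"
    have R: "(\<Sum>k\<le>j. A (Suc k)) \<le> R" "R \<ge> 0"
      unfolding R_def using A0 by (auto simp: sum.atMost_Suc_shift sum_nonneg simp del: sum.atMost_Suc)
    have A': "cmod (F k x) \<le> (B * A k) * (b - x) powr - p" if "x \<in> {0..<b}" for k x
    proof -
      have "cmod (F k x) \<le> A k * ((b - x) powr (p - N) * (b - x) powr - p)"
        unfolding powr_add[symmetric] using A[OF that] by (simp add: powr_minus divide_inverse)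
      also have "\<dots> \<le> A k * (B * (b - x) powr - p)"
        unfolding B_def using that pN A0 by (intro mult_left_mono mult_right_mono powr_mono2) auto
      finally show ?thesis by (simp add: mult_ac)
    qed
    let ?\<phi> = "\<lambda>x. - (2 * D * B * R) * (b - x) powr (1/2)"
    have "cmod (F 0 t - F 0 s) \<le> ?\<phi> t - ?\<phi> s"
    proof (rule derivative_chain_growth[OF F st])
      fix x assume x: "0 \<le> x" "x < b"
      show "(?\<phi> has_real_derivative D * B * R * (b - x) powr (- 1/2)) (at x)"
        using x by (auto intro!: derivative_eq_intros)
      have "cmod (F 1 x) \<le> D * (\<Sum>k\<le>j. B * A (Suc k)) * (b - x) powr (real j - p)"
        using D(2)[OF derivative_chain_shift[OF F], of "\<lambda>k. B * A (Suc k)" x] A' x by auto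
      also have "\<dots> = D * B * (\<Sum>k\<le>j. A (Suc k)) * (b - x) powr (- 1/2)"
        by (simp add: sum_distrib_left[symmetric] p_def)
      also have "\<dots> \<le> D * B * R * (b - x) powr (- 1/2)"
        using R D(1) B by (auto intro!: mult_right_mono mult_left_mono)
      finally show "cmod (F 1 x) \<le> D * B * R * (b - x) powr (- 1/2)" .
    qed
    then show ?thesis
      unfolding R_def[symmetric] using st by (simp add: powr_half_sqrt algebra_simps)
  qed
  show thesis
  proof (rule that[of "2 * D * B" "Suc j"])
    fix F A s t
    assume h: "derivative_chain b F" "\<And>k t. t \<in> {0..<b} \<Longrightarrow> cmod (F k t) \<le> A k / (b - t) powr N"
      "s \<in> {0..<b}" "t \<in> {0..<b}"
    show "cmod (F 0 t - F 0 s) \<le> 2 * D * B * (\<Sum>k\<le>Suc j. A k) * \<bar>sqrt (b - t) - sqrt (b - s)\<bar>"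
    proof (cases "s \<le> t")
      case True
      then show ?thesis using main[OF h(1,2), of s t] h(3,4) by (simp add: abs_if)
    next
      case False
      then show ?thesis using main[OF h(1,2), of t s] h(3,4) by (simp add: abs_if norm_minus_commute)
    qed
  qed (use D(1) B in simp)
qed

text \<open>Differentiating \<open>t^j / j!\<close> lowers \<open>j\<close> by one, which amounts to
  shifting the coefficients; so the series of index \<open>k\<close> differentiates to that of index
  \<open>k + 1\<close>.\<close>

lemma power_series_vector_derivative:
  fixes c :: "nat \<Rightarrow> complex"
  assumes sums: "\<And>k t. t \<in> {0..<b} \<Longrightarrow>
      (\<lambda>j. complex_of_real (t ^ j / fact j) * c (k + j)) sums F k t"
  shows "derivative_chain b F"
  unfolding derivative_chain_def
proof (intro allI ballI)
  fix k t assume t: "t \<in> {0..<b}"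
  let ?a = "\<lambda>j. c (k + j) / fact j"
  \<comment> \<open>A point of summability beyond \<open>t\<close>, so that \<open>t\<close> lies
    strictly inside the disc of convergence.\<close>
  define K where "K = (t + b) / 2"
  have K: "K \<in> {0..<b}" "\<bar>t\<bar> < \<bar>K\<bar>" using t by (auto simp: K_def)
  have eq: "?a j * complex_of_real x ^ j = complex_of_real (x ^ j / fact j) * c (k + j)" for x j
    by simp
  have "summable (\<lambda>j. ?a j * complex_of_real K ^ j)"
    unfolding eq using sums[OF K(1)] by (rule sums_summable)
  then have "DERIV (\<lambda>z. \<Sum>j. ?a j * z ^ j) (complex_of_real t)
      :> (\<Sum>j. diffs ?a j * complex_of_real t ^ j)"
    by (rule termdiffs_strong) (use K in simp)
  moreover have "diffs ?a j * complex_of_real t ^ j = complex_of_real (t ^ j / fact j) * c (Suc k + j)" for j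
    by (simp add: diffs_def field_simps del: of_nat_Suc)
  ultimately have "DERIV (\<lambda>z. \<Sum>j. ?a j * z ^ j) (complex_of_real t) :> F (Suc k) t"
    using sums_unique[OF sums[OF t, of "Suc k"]] by simp
  then have "((\<lambda>x. \<Sum>j. ?a j * complex_of_real x ^ j) has_vector_derivative F (Suc k) t) (at t within {0..<b})"
    by (rule has_vector_derivative_real_field)
  then show "(F k has_vector_derivative F (Suc k) t) (at t within {0..<b})"
    by (rule has_vector_derivative_transform[OF t, rotated]) (simp only: eq sums_unique[OF sums])
qed

text \<open>Completeness is used along one sequence only. Letting its points tend to
  \<open>b\<close> in the modulus gives a rate for the whole left limit and, at
  \<open>t = 0\<close>, the bound on \<open>L\<close>.\<close>

lemma tendsto_at_left_of_modulus:
  fixes f :: "real \<Rightarrow> complex"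
  assumes "b > 0" and c: "c \<ge> 0" and le: "\<And>s t. s \<in> {0..<b} \<Longrightarrow> t \<in> {0..<b} \<Longrightarrow>
      cmod (f t - f s) \<le> c * \<bar>sqrt (b - t) - sqrt (b - s)\<bar>"
  obtains L where "(f \<longlongrightarrow> L) (at_left b)" "cmod (L - f 0) \<le> c * sqrt b"
proof -
  define \<tau> where "\<tau> n = b - b / real (Suc n)" for n
  have \<tau>: "\<tau> n \<in> {0..<b}" for n
    using assms(1) by (auto simp: \<tau>_def field_simps)
  have "(\<lambda>n. sqrt (b * (1 / real (Suc n)))) \<longlonglongrightarrow> sqrt (b * 0)"
    by (intro tendsto_intros LIMSEQ_Suc[OF lim_1_over_n])
  then have g0: "(\<lambda>n. sqrt (b - \<tau> n)) \<longlonglongrightarrow> 0" by (simp add: \<tau>_def)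
  have "Cauchy (\<lambda>n. f (\<tau> n))"
  proof (rule metric_CauchyI)
    fix e :: real assume "e > 0"
    \<comment> \<open>Dividing by \<open>c + 1\<close> also covers \<open>c = 0\<close>.\<close>
    then have "e / (c + 1) > 0" using c by simp
    with LIMSEQ_imp_Cauchy[OF g0] obtain M where
      M: "\<And>i j. i \<ge> M \<Longrightarrow> j \<ge> M \<Longrightarrow> dist (sqrt (b - \<tau> i)) (sqrt (b - \<tau> j)) < e / (c + 1)"
      unfolding Cauchy_def by blast
    have "dist (f (\<tau> i)) (f (\<tau> j)) < e" if "i \<ge> M" "j \<ge> M" for i j
    proof -
      have "dist (f (\<tau> i)) (f (\<tau> j)) \<le> c * dist (sqrt (b - \<tau> i)) (sqrt (b - \<tau> j))"
        using le[OF \<tau> \<tau>] by (simp add: dist_norm)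
      also have "\<dots> \<le> c * (e / (c + 1))" using M[OF that] c by (intro mult_left_mono) auto
      also have "\<dots> < e" using c \<open>e > 0\<close> by (simp add: field_simps)
      finally show ?thesis .
    qed
    then show "\<exists>M. \<forall>i\<ge>M. \<forall>j\<ge>M. dist (f (\<tau> i)) (f (\<tau> j)) < e" by blast
  qed
  then obtain L where L: "(\<lambda>n. f (\<tau> n)) \<longlonglongrightarrow> L" using Cauchy_convergent convergent_def by blast
  have bnd: "cmod (L - f t) \<le> c * sqrt (b - t)" if t: "t \<in> {0..<b}" for t
  proof (rule LIMSEQ_le)
    show "(\<lambda>n. cmod (f (\<tau> n) - f t)) \<longlonglongrightarrow> cmod (L - f t)"
      by (intro tendsto_intros L)
    have "(\<lambda>n. c * \<bar>sqrt (b - \<tau> n) - sqrt (b - t)\<bar>) \<longlonglongrightarrow> c * \<bar>0 - sqrt (b - t)\<bar>"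
      by (intro tendsto_intros g0)
    then show "(\<lambda>n. c * \<bar>sqrt (b - \<tau> n) - sqrt (b - t)\<bar>) \<longlonglongrightarrow> c * sqrt (b - t)"
      using t by simp
    show "\<exists>M. \<forall>n\<ge>M. cmod (f (\<tau> n) - f t) \<le> c * \<bar>sqrt (b - \<tau> n) - sqrt (b - t)\<bar>"
      using le[OF t \<tau>] by blast
  qed
  show thesis
  proof (rule that)
    show "cmod (L - f 0) \<le> c * sqrt b" using bnd[of 0] assms(1) by simp
    have "((\<lambda>t. c * sqrt (b - t)) \<longlongrightarrow> c * sqrt (b - b)) (at_left b)"
      by (intro tendsto_intros)
    then have lim: "((\<lambda>t. c * sqrt (b - t)) \<longlongrightarrow> 0) (at_left b)" by simp
    have "((\<lambda>t. f t - L) \<longlongrightarrow> 0) (at_left b)"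
    proof (rule Lim_null_comparison[where g="\<lambda>t. c * sqrt (b - t)"])
      show "\<forall>\<^sub>F t in at_left b. norm (f t - L) \<le> c * sqrt (b - t)"
        using eventually_at_left_real[OF assms(1)]
        by eventually_elim (use bnd in \<open>auto simp: norm_minus_commute\<close>)
    qed (rule lim)
    then show "(f \<longlongrightarrow> L) (at_left b)" by (rule LIM_zero_cancel)
  qed
qed

section \<open>Distribution vectors\<close>

text \<open>\<open>D\<close> and \<open>K\<close> are fixed before the orbit, and truncation
  increases no \<open>norm (U k)\<close>; hence the estimate for bounded orbits survives the removal
  of the cutoff.\<close>

lemma cinner_exp_op_modulus:
  fixes H :: "'a::complex_hilbert operator"
  assumes sa: "selfadjoint_op H" and b: "b > 0"
    and w: "\<And>t. t \<in> {0..<b} \<Longrightarrow> (v, w t) \<in> exp_op t H"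
    and le: "\<And>t. t \<in> {0..<b} \<Longrightarrow> norm (w t) \<le> C / (b - t) powr N"
  obtains D K where "D \<ge> 0" "\<And>U s t. power_orbit H U \<Longrightarrow> s \<in> {0..<b} \<Longrightarrow> t \<in> {0..<b} \<Longrightarrow>
    cmod (cinner (U 0) (w t) - cinner (U 0) (w s))
      \<le> D * (\<Sum>k\<le>K::nat. norm (U k)) * \<bar>sqrt (b - t) - sqrt (b - s)\<bar>"
proof -
  obtain D K where D: "D \<ge> 0" "\<And>F A s t. derivative_chain b F \<Longrightarrow>
    (\<And>k t. t \<in> {0..<b} \<Longrightarrow> cmod (F k t) \<le> A k / (b - t) powr N) \<Longrightarrow>
    s \<in> {0..<b} \<Longrightarrow> t \<in> {0..<b} \<Longrightarrow>
    cmod (F 0 t - F 0 s) \<le> D * (\<Sum>k\<le>K::nat. A k) * \<bar>sqrt (b - t) - sqrt (b - s)\<bar>"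
    using derivative_chain_modulus[OF b, of N] by blast
  have C: "C \<ge> 0"
    using order_trans[OF norm_ge_zero le[of 0]] b by (simp add: zero_le_divide_iff)
  \<comment> \<open>A spectral measure is read off from membership in \<open>exp_op 0 H\<close>, not
    taken from the spectral theorem.\<close>
  obtain E where "spectral_op E H" by (rule exp_opE[OF w[of 0]]) (use b in auto)
  then interpret spectral_op E H .
  have shift: "bounded_orbit H (\<lambda>j. U (k + j))" if "bounded_orbit H U" for U k
    using that by (induction k) (auto dest: bounded_orbit_shift)
  have bounded: "cmod (cinner (U 0) (w t) - cinner (U 0) (w s))
      \<le> D * (\<Sum>k\<le>K. norm (U k) * C) * \<bar>sqrt (b - t) - sqrt (b - s)\<bar>"
    if U: "bounded_orbit H U" and st: "s \<in> {0..<b}" "t \<in> {0..<b}" for U s t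
  proof (rule D(2)[OF _ _ st])
    \<comment> \<open>The orbit shifted by \<open>k\<close> supplies the series of the
      \<open>k\<close>-th derivative.\<close>
    show "derivative_chain b (\<lambda>k t. cinner (U k) (w t))"
      by (rule power_series_vector_derivative[where c="\<lambda>k. cinner (U k) v"])
        (use cinner_exp_op_sums[OF sa w shift[OF U]] in simp)
    show "cmod (cinner (U k) (w t)) \<le> norm (U k) * C / (b - t) powr N" if "t \<in> {0..<b}" for k t
    proof -
      have "cmod (cinner (U k) (w t)) \<le> norm (U k) * norm (w t)" by (rule cmod_cinner_le)
      also have "\<dots> \<le> norm (U k) * (C / (b - t) powr N)" by (intro mult_left_mono le that) simp
      finally show ?thesis by simp
    qed
  qed
  show thesis
  proof (rule that[of "D * C" K])
    fix U s t
    assume U: "power_orbit H U" and st: "s \<in> {0..<b}" "t \<in> {0..<b}"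
    let ?g = "\<bar>sqrt (b - t) - sqrt (b - s)\<bar>"
    show "cmod (cinner (U 0) (w t) - cinner (U 0) (w s)) \<le> D * C * (\<Sum>k\<le>K. norm (U k)) * ?g"
    proof (rule LIMSEQ_le_const2)
      show "(\<lambda>m. cmod (cinner (cutoff m (U 0)) (w t) - cinner (cutoff m (U 0)) (w s)))
          \<longlonglongrightarrow> cmod (cinner (U 0) (w t) - cinner (U 0) (w s))"
        by (intro tendsto_intros bounded_linear.tendsto[OF bounded_linear_cinner_left] cutoff_tendsto)
      have "cmod (cinner (cutoff m (U 0)) (w t) - cinner (cutoff m (U 0)) (w s)) \<le> D * C * (\<Sum>k\<le>K. norm (U k)) * ?g" for m
      proof -
        have "(\<Sum>k\<le>K. norm (cutoff m (U k)) * C) \<le> (\<Sum>k\<le>K. norm (U k)) * C"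
          unfolding sum_distrib_right using C by (intro sum_mono mult_right_mono norm_cutoff_le)
        then have "D * (\<Sum>k\<le>K. norm (cutoff m (U k)) * C) * ?g \<le> D * ((\<Sum>k\<le>K. norm (U k)) * C) * ?g"
          using D(1) by (intro mult_right_mono mult_left_mono) auto
        with bounded[OF bounded_orbit_cutoff[OF U] st, of m] show ?thesis by (simp add: mult_ac)
      qed
      then show "\<exists>M. \<forall>m\<ge>M. cmod (cinner (cutoff m (U 0)) (w t) - cinner (cutoff m (U 0)) (w s))
          \<le> D * C * (\<Sum>k\<le>K. norm (U k)) * ?g" by blast
    qed
  qed (use D(1) C in simp)
qed

section \<open>Powers of the operator and the topology of smooth vectors\<close>

lemma linear_operator_relcomp:
  assumes "linear_operator S" "linear_operator T"
  shows "linear_operator (S O T)"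
  using assms unfolding linear_operator_def by (blast intro: single_valued_relcomp)

lemma linear_operator_relpow: "linear_operator T \<Longrightarrow> linear_operator (T ^^ n)"
  by (induction n) (auto simp: linear_operator_relcomp, auto simp: linear_operator_def)

lemma op_apply_eqI: "single_valued T \<Longrightarrow> (x, y) \<in> T \<Longrightarrow> op_apply T x = y"
  unfolding op_apply_def single_valued_def by (blast intro: the_equality)

context
  fixes H :: "'a::complex_hilbert operator"
  assumes H: "linear_operator H"
begin

lemma
  shows single_valued_relpow: "single_valued (H ^^ n)"
    and relpow_zero: "(0, 0) \<in> H ^^ n"
    and relpow_add: "(x, y) \<in> H ^^ n \<Longrightarrow> (x', y') \<in> H ^^ n \<Longrightarrow> (x + x', y + y') \<in> H ^^ n"
    and relpow_scaleC: "(x, y) \<in> H ^^ n \<Longrightarrow> (a *\<^sub>C x, a *\<^sub>C y) \<in> H ^^ n"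
  using linear_operator_relpow[OF H, of n] unfolding linear_operator_def by blast+

lemma smooth_vectors_relpow: "u \<in> smooth_vectors H \<Longrightarrow> (u, op_apply (H ^^ n) u) \<in> H ^^ n"
  unfolding smooth_vectors_def using op_apply_eqI[OF single_valued_relpow] by blast

lemma smooth_vectors_zero: "0 \<in> smooth_vectors H"
  unfolding smooth_vectors_def using relpow_zero by blast

lemma smooth_vectors_add:
  "u \<in> smooth_vectors H \<Longrightarrow> w \<in> smooth_vectors H \<Longrightarrow> u + w \<in> smooth_vectors H"
  using relpow_add[OF smooth_vectors_relpow smooth_vectors_relpow] unfolding smooth_vectors_def by blast

lemma smooth_vectors_scaleC: "u \<in> smooth_vectors H \<Longrightarrow> a *\<^sub>C u \<in> smooth_vectors H"
  using relpow_scaleC[OF smooth_vectors_relpow] unfolding smooth_vectors_def by blast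

lemma smooth_vectors_diff:
  "u \<in> smooth_vectors H \<Longrightarrow> w \<in> smooth_vectors H \<Longrightarrow> u - w \<in> smooth_vectors H"
  using smooth_vectors_add[OF _ smooth_vectors_scaleC[of w "-1"], of u] by (simp add: scaleC_minus_one)

text \<open>Single-valuedness of the powers identifies the intermediate point in
  \<open>H ^^ Suc k\<close> with the value of \<open>H ^^ k\<close>, so the separate values fit
  together into one orbit.\<close>

lemma power_orbit_smooth:
  assumes "u \<in> smooth_vectors H"
  shows "power_orbit H (\<lambda>k. op_apply (H ^^ k) u)"
  unfolding power_orbit_def
proof
  fix k
  obtain z where "(u, z) \<in> H ^^ k" "(z, op_apply (H ^^ Suc k) u) \<in> H"
    using smooth_vectors_relpow[OF assms, of "Suc k"] by (auto elim: relpow_Suc_E)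
  then show "(op_apply (H ^^ k) u, op_apply (H ^^ Suc k) u) \<in> H"
    using op_apply_eqI[OF single_valued_relpow] by metis
qed

lemma topspace_smooth_topology: "topspace (smooth_topology H) = smooth_vectors H"
proof
  show "topspace (smooth_topology H) \<subseteq> smooth_vectors H"
    unfolding smooth_topology_def topology_generated_by_topspace by auto
  show "smooth_vectors H \<subseteq> topspace (smooth_topology H)"
  proof
    fix u assume u: "u \<in> smooth_vectors H"
    \<comment> \<open>A subbasic ball about 0 for the zeroth seminorm; the added 1 makes the
      inequality strict and the radius positive.\<close>
    let ?B = "{u' \<in> smooth_vectors H. norm (op_apply (H ^^ 0) (u' - 0)) < norm (op_apply (H ^^ 0) u) + 1}"
    have "0 < norm (op_apply (H ^^ 0) u) + 1" by (intro add_nonneg_pos) simp_all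
    then have "openin (smooth_topology H) ?B"
      unfolding smooth_topology_def using smooth_vectors_zero
      by (intro topology_generated_by_Basis CollectI exI[of _ "0::nat"] exI[of _ "0::'a"]
          exI[of _ "norm (op_apply (H ^^ 0) u) + 1"] conjI refl)
    moreover have "u \<in> ?B" using u by simp
    ultimately show "u \<in> topspace (smooth_topology H)" using openin_subset by blast
  qed
qed

text \<open>Balls of single seminorms form only a subbasis, so a neighbourhood adapted to the sum is
  an intersection of \<open>K + 1\<close> of them.\<close>

lemma continuous_map_smooth_topology:
  fixes \<phi> :: "'a \<Rightarrow> complex"
  assumes D: "D \<ge> 0" and le: "\<And>u w. u \<in> smooth_vectors H \<Longrightarrow> w \<in> smooth_vectors H \<Longrightarrow>
     cmod (\<phi> u - \<phi> w) \<le> D * (\<Sum>k\<le>K::nat. norm (op_apply (H ^^ k) (u - w)))"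
  shows "continuous_map (smooth_topology H) euclidean \<phi>"
  unfolding continuous_map_def topspace_smooth_topology
proof (intro conjI allI impI)
  fix V :: "complex set" assume "openin euclidean V"
  then have "open V" by simp
  show "openin (smooth_topology H) {u \<in> smooth_vectors H. \<phi> u \<in> V}"
  proof (subst openin_subopen, intro ballI)
    fix w assume "w \<in> {u \<in> smooth_vectors H. \<phi> u \<in> V}"
    then have w: "w \<in> smooth_vectors H" "\<phi> w \<in> V" by auto
    then obtain e where e: "e > 0" "ball (\<phi> w) e \<subseteq> V"
      using \<open>open V\<close> open_contains_ball by blast
    \<comment> \<open>\<open>K + 1\<close> terms below \<open>r\<close> sum to at most
      \<open>e / (D + 1)\<close>; the added 1 covers \<open>D = 0\<close>.\<close>
    define r where "r = e / ((D + 1) * (real K + 1))"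
    have r: "r > 0" using e D by (simp add: r_def)
    define T where "T = (\<Inter>n\<in>{..K}. {u \<in> smooth_vectors H. norm (op_apply (H ^^ n) (u - w)) < r})"
    have "openin (smooth_topology H) T"
      unfolding T_def smooth_topology_def
      by (rule openin_INT2) (use w r in \<open>auto intro!: topology_generated_by_Basis\<close>)
    moreover have "w \<in> T"
      using w r op_apply_eqI[OF single_valued_relpow relpow_zero] by (simp add: T_def)
    moreover have "T \<subseteq> {u \<in> smooth_vectors H. \<phi> u \<in> V}"
    proof
      fix u assume u: "u \<in> T"
      then have us: "u \<in> smooth_vectors H" by (auto simp: T_def)
      have "cmod (\<phi> u - \<phi> w) \<le> D * (\<Sum>k\<le>K. norm (op_apply (H ^^ k) (u - w)))"
        by (rule le[OF us w(1)])
      also have "\<dots> \<le> D * (\<Sum>k\<le>K. r)"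
        using u D by (intro mult_left_mono sum_mono) (auto simp: T_def less_imp_le)
      also have "(\<Sum>k\<le>K. r) = e / (D + 1)" by (simp add: r_def add.commute)
      also have "D * (e / (D + 1)) < e" using D e by (simp add: field_simps)
      finally show "u \<in> {u \<in> smooth_vectors H. \<phi> u \<in> V}"
        using e(2) us by (auto simp: dist_norm norm_minus_commute subset_iff)
    qed
    ultimately show "\<exists>T. openin (smooth_topology H) T \<and> w \<in> T \<and> T \<subseteq> {u \<in> smooth_vectors H. \<phi> u \<in> V}"
      by blast
  qed
qed auto

lemma distribution_vectorsI:
  assumes ext: "\<phi> \<in> extensional (smooth_vectors H)"
    and add: "\<And>u w. u \<in> smooth_vectors H \<Longrightarrow> w \<in> smooth_vectors H \<Longrightarrow> \<phi> (u + w) = \<phi> u + \<phi> w"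
    and scale: "\<And>a u. u \<in> smooth_vectors H \<Longrightarrow> \<phi> (a *\<^sub>C u) = cnj a * \<phi> u"
    and D: "D \<ge> 0" and le: "\<And>u. u \<in> smooth_vectors H \<Longrightarrow>
      cmod (\<phi> u) \<le> D * (\<Sum>k\<le>K::nat. norm (op_apply (H ^^ k) u))"
  shows "\<phi> \<in> distribution_vectors H"
proof -
  have "continuous_map (smooth_topology H) euclidean \<phi>"
  proof (rule continuous_map_smooth_topology[OF D])
    fix u w assume uw: "u \<in> smooth_vectors H" "w \<in> smooth_vectors H"
    have "\<phi> ((u - w) + w) = \<phi> (u - w) + \<phi> w" using uw by (intro add smooth_vectors_diff)
    then have "\<phi> u - \<phi> w = \<phi> (u - w)" by simp
    then show "cmod (\<phi> u - \<phi> w) \<le> D * (\<Sum>k\<le>K. norm (op_apply (H ^^ k) (u - w)))"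
      using le[OF smooth_vectors_diff[OF uw]] by simp
  qed
  then show ?thesis unfolding distribution_vectors_def using ext add scale by blast
qed

text \<open>Convergence in a subtopology requires the approximants to lie in the subspace;
  Cauchy-Schwarz gives this with the zeroth seminorm alone.\<close>

lemma distribution_of_vector_mem: "distribution_of_vector H w \<in> distribution_vectors H"
proof (rule distribution_vectorsI[of _ "norm w" 0])
  fix u assume "u \<in> smooth_vectors H"
  then show "cmod (distribution_of_vector H w u) \<le> norm w * (\<Sum>k\<le>0. norm (op_apply (H ^^ k) u))"
    using cmod_cinner_le[of u w] op_apply_eqI[of Id u u]
    by (simp add: distribution_of_vector_def mult.commute)
qed (auto simp: distribution_of_vector_def smooth_vectors_add smooth_vectors_scaleC
    cinner_add_left cinner_scaleC_left)

end

theorem theorem2p21: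
  fixes H :: "'a::complex_hilbert operator" and b :: real and v :: 'a
  assumes "selfadjoint_op H"
    and "b > 0"
    and "\<forall>t \<in> {0..<b}. v \<in> Domain (exp_op t H)"
    and "\<exists>C > 0. \<exists>N > 0. \<forall>t \<in> {0..<b}.
           norm (op_apply (exp_op t H) v) \<le> C / (b - t) powr N"
  shows "\<exists>\<eta>. limitin (distribution_topology H)
           (\<lambda>t. distribution_of_vector H (op_apply (exp_op t H) v)) \<eta> (at_left b)"
proof -
  have lin: "linear_operator H" using assms(1) by (simp add: selfadjoint_op_def)
  define w where "w t = op_apply (exp_op t H) v" for t
  have w: "(v, w t) \<in> exp_op t H" if "t \<in> {0..<b}" for t
    unfolding w_def using assms(3) that by (intro op_apply_exp_op[OF assms(1)]) blast
  obtain C N where CN: "\<And>t. t \<in> {0..<b} \<Longrightarrow> norm (w t) \<le> C / (b - t) powr N"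
    using assms(4) unfolding w_def by blast
  obtain D K where D: "D \<ge> 0" "\<And>U s t. power_orbit H U \<Longrightarrow> s \<in> {0..<b} \<Longrightarrow> t \<in> {0..<b} \<Longrightarrow>
    cmod (cinner (U 0) (w t) - cinner (U 0) (w s))
      \<le> D * (\<Sum>k\<le>K::nat. norm (U k)) * \<bar>sqrt (b - t) - sqrt (b - s)\<bar>"
    by (rule cinner_exp_op_modulus[OF assms(1,2) w CN]) blast+
  define q where "q u = (\<Sum>k\<le>K. norm (op_apply (H ^^ k) u))" for u
  have q: "norm u \<le> q u" for u
  proof -
    have "norm (op_apply (H ^^ 0) u) \<le> q u"
      unfolding q_def by (rule member_le_sum) auto
    then show ?thesis using op_apply_eqI[of Id u u] by simp
  qed
  \<comment> \<open>The bound compares \<open>L\<close> with the value at \<open>t = 0\<close>: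
    Cauchy-Schwarz there contributes \<open>norm (w 0)\<close>, the modulus contributes
    \<open>D * sqrt b\<close>.\<close>
  have ex: "\<exists>L. ((\<lambda>t. cinner u (w t)) \<longlongrightarrow> L) (at_left b) \<and> cmod L \<le> (D * sqrt b + norm (w 0)) * q u"
    if u: "u \<in> smooth_vectors H" for u
  proof -
    have u0: "op_apply (H ^^ 0) u = u" using op_apply_eqI[of Id u u] by simp
    have "0 \<le> D * q u" by (rule mult_nonneg_nonneg[OF D(1) order_trans[OF norm_ge_zero q]])
    moreover have "cmod (cinner u (w t) - cinner u (w s)) \<le> (D * q u) * \<bar>sqrt (b - t) - sqrt (b - s)\<bar>"
      if "s \<in> {0..<b}" "t \<in> {0..<b}" for s t
      using D(2)[OF power_orbit_smooth[OF lin u] that] unfolding q_def u0 .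
    ultimately obtain L where L: "((\<lambda>t. cinner u (w t)) \<longlongrightarrow> L) (at_left b)"
        "cmod (L - cinner u (w 0)) \<le> (D * q u) * sqrt b"
      using tendsto_at_left_of_modulus[OF assms(2), of "D * q u" "\<lambda>t. cinner u (w t)"] by blast
    have "cmod L \<le> cmod (cinner u (w 0)) + cmod (L - cinner u (w 0))"
      using norm_triangle_sub[of L "cinner u (w 0)"] by simp
    also have "\<dots> \<le> q u * norm (w 0) + (D * q u) * sqrt b"
      using L(2) order_trans[OF cmod_cinner_le mult_right_mono[OF q norm_ge_zero]] by (rule add_mono[rotated])
    finally show ?thesis using L(1) by (auto simp: algebra_simps)
  qed
  \<comment> \<open>Off the smooth vectors \<open>restrict\<close> returns \<open>undefined\<close>,
    as \<open>extensional\<close> demands; on them \<open>Lim\<close> names the limit just shown to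
    exist.\<close>
  define \<eta> where "\<eta> = restrict (\<lambda>u. Lim (at_left b) (\<lambda>t. cinner u (w t))) (smooth_vectors H)"
  have \<eta>: "((\<lambda>t. cinner u (w t)) \<longlongrightarrow> \<eta> u) (at_left b)"
    "cmod (\<eta> u) \<le> (D * sqrt b + norm (w 0)) * q u" if u: "u \<in> smooth_vectors H" for u
    using ex[OF u] u tendsto_Lim[OF trivial_limit_at_left_real] unfolding \<eta>_def by auto
  have "\<eta> \<in> distribution_vectors H"
  proof (rule distribution_vectorsI[OF lin])
    show "\<eta> \<in> extensional (smooth_vectors H)" by (simp add: \<eta>_def)
    show "\<eta> (u + u') = \<eta> u + \<eta> u'" if "u \<in> smooth_vectors H" "u' \<in> smooth_vectors H" for u u'
      using tendsto_add[OF \<eta>(1)[OF that(1)] \<eta>(1)[OF that(2)]] \<eta>(1)[OF smooth_vectors_add[OF lin that]]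
      unfolding cinner_add_left by (intro tendsto_unique[OF trivial_limit_at_left_real])
    show "\<eta> (a *\<^sub>C u) = cnj a * \<eta> u" if "u \<in> smooth_vectors H" for a u
      using tendsto_mult_left[OF \<eta>(1)[OF that], of "cnj a"] \<eta>(1)[OF smooth_vectors_scaleC[OF lin that]]
      unfolding cinner_scaleC_left by (intro tendsto_unique[OF trivial_limit_at_left_real])
    show "cmod (\<eta> u) \<le> (D * sqrt b + norm (w 0)) * (\<Sum>k\<le>K. norm (op_apply (H ^^ k) u))"
      if "u \<in> smooth_vectors H" for u using \<eta>(2)[OF that] unfolding q_def .
  qed (use D(1) assms(2) in simp)
  \<comment> \<open>Convergence in the product topology is pointwise convergence on smooth vectors,
    so the scalar limits suffice.\<close>
  moreover have "limitin (product_topology (\<lambda>_. euclidean) (smooth_vectors H))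
      (\<lambda>t. distribution_of_vector H (w t)) \<eta> (at_left b)"
    unfolding limitin_componentwise using \<eta>(1)
    by (auto simp: \<eta>_def distribution_of_vector_def)
  ultimately have "limitin (distribution_topology H) (\<lambda>t. distribution_of_vector H (w t)) \<eta> (at_left b)"
    unfolding distribution_topology_def limitin_subtopology
    by (simp add: distribution_of_vector_mem[OF lin])
  then show ?thesis unfolding w_def by blast
qed

end
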